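(* Suppose $\lambda\in(0,1)$ and $d\in(0,1-\lambda)$. Let $\rho\in(0,1)$ and $\alpha\in[0,1]$. Then, for every $\delta\in(1-\lambda-d,1)$ and $a\in[0,1]$ such that $$\delta\in[\delta(\rho^-,\alpha),\delta(\rho,\alpha)]\quad\text{and}\quad a\in[a(\delta,\rho^+,\alpha),a(\delta,\rho,\alpha)],\qquad ( * )$$ the rotation number of the map $f=f_{\delta,a}$ is $\rho$. Moreover, 1. We have $[\delta(\rho^-,\alpha),\delta(\rho,\alpha)]\subset(1-\lambda-d,1)$, and if $\delta\in[\delta(\rho^-,\alpha),\delta(\rho,\alpha)]$, then $[a(\delta,\rho^+,\alpha),a(\delta,\rho,\alpha)]\cap[0,1]\neq\emptyset$, with $[a(\delta,\rho^+,\alpha),a(\delta,\rho,\alpha)]\subset[0,1]$ if $\alpha\in(0,1)$ or $\rho\notin\mathbb{Q}$. 2. If $\rho\in(0,1)\setminus\mathbb{Q}$, then $$\delta(\rho^-,\alpha)=\delta(\rho,\alpha)\quad\text{and}\quad a(\delta,\rho,\alpha)=a(\delta,\rho^+,\alpha)\quad\forall\delta\in[0,1]$$ if $k\rho\notin\mathbb{Z}+\alpha$ for every $k\in\mathbb{Z}\setminus\{0\}$, and otherwise either $\delta(\rho^-,\alpha)<\delta(\rho,\alpha)$ or $a(\delta,\rho^+,\alpha)<a(\delta,\rho,\alpha)$. 3. If $\rho=p/q$, where $0<p<q$ are co-prime, then $$\delta(\rho,\alpha)-\delta(\rho^-,\alpha)\geq\frac{\lambda^{q-1}}{1-\lambda^q}(1-\lambda)\bigl(1-\lambda-d+d\,\mathbf{1}_{\{0,1\}}(\alpha)\bigr)$$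 and $$a(\delta,\rho,\alpha)-a(\delta,\rho^+,\alpha)\geq\frac{\lambda^{q-1}}{1-\lambda^q}\bigl((1-\lambda-d)\mathbf{1}_{\{0,1\}}(\alpha)+d\bigr)\quad\forall\delta\in[0,1].$$ Moreover, these two inequalities are equalities if and only if $rp/q\notin\mathbb{Z}+\alpha$ for every $r\in\{1,\dots,q-1\}$.
   Context: Notation: $\lfloor x\rfloor$ is the integer part and $\{x\}=x-\lfloor x\rfloor$ the fractional part of $x\in\mathbb{R}$. For $c\in\mathbb{R}$, $\theta_c(z)=0$ if $z<c$ and $\theta_c(z)=1$ if $z\ge c$. $\mathbf{1}_A$ is the indicator function of $A\subset\mathbb{R}$. For $\lambda\in(0,1)$, $d\in(0,1-\lambda)$ and $\delta,a\in[0,1]$, let $F:\mathbb{R}\to\mathbb{R}$, $F(x)=\lambda x+\delta+(1-\lambda)\lfloor x\rfloor+d\,\theta_a(\{x\})$, and let $f=f_{\delta,a}:[0,1)\to[0,1)$, $f(x)=F(x)\pmod 1$. The rotation number of $f$ is $\rho_f=\lim_{n\to\infty}F^n(x)/n\pmod 1$; $F$ is increasing with $F(x+1)=F(x)+1$, so this limit exists and does not depend on $x\in\mathbb{R}$. For $\rho,\alpha\in[0,1]$ define $$\delta(\rho,\alpha)=1-\lambda-d+\frac{1-\lambda}{\lambda}\sum_{k=1}^{\infty}\lambda^k\left((1-\lambda)\lfloor k\rho\rfloor+d\,\theta_{1-\alpha}(\{k\rho\})\right),$$ $$a(\delta,\rho,\alpha)=\frac{\delta}{1-\lambda}+\frac1\lambda\sum_{k=1}^{\infty}\lambda^k\left((1-\lambda)\lfloor\alpha-k\rho\rfloor+d\,\theta_\alpha(\{\alpha-k\rho\})\right)\quad\forall\delta\in[0,1].$$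 For $\rho\in(0,1)$ the one-sided limits are denoted $\delta(\rho^-,\alpha)=\lim_{r\to\rho^-}\delta(r,\alpha)$ and $a(\delta,\rho^+,\alpha)=\lim_{r\to\rho^+}a(\delta,r,\alpha)$. *)

theory Defs
  imports "HOL-Analysis.Analysis"
begin

definition step :: "real \<Rightarrow> real \<Rightarrow> real" where
  "step c z = (if z < c then 0 else 1)"

definition lift_map :: "real \<Rightarrow> real \<Rightarrow> real \<Rightarrow> real \<Rightarrow> real \<Rightarrow> real" where
  "lift_map lam d \<delta> a x =
     lam * x + \<delta> + (1 - lam) * real_of_int \<lfloor>x\<rfloor> + d * step a (frac x)"

text \<open>
  The rotation number of the circle map \<open>f x = frac (F x)\<close> on \<open>[0,1)\<close> is by definition
  computed from the lift \<open>F = lift_map lam d \<delta> a\<close>: it is the limit of \<open>F\<^sup>n x / n\<close>,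
  which must exist and be the same for all real \<open>x\<close>, reduced modulo 1.
\<close>

definition has_rotation_number :: "(real \<Rightarrow> real) \<Rightarrow> real \<Rightarrow> bool" where
  "has_rotation_number F \<rho> \<longleftrightarrow>
     (\<exists>L. (\<forall>x. (\<lambda>n. (F ^^ n) x / real n) \<longlonglongrightarrow> L) \<and> \<rho> = frac L)"

text \<open>The series below run over \<open>k = Suc n \<ge> 1\<close>.\<close>

definition delta_fun :: "real \<Rightarrow> real \<Rightarrow> real \<Rightarrow> real \<Rightarrow> real" where
  "delta_fun lam d \<rho> \<alpha> =
     1 - lam - d + (1 - lam) / lam *
       (\<Sum>n. lam ^ Suc n * ((1 - lam) * real_of_int \<lfloor>real (Suc n) * \<rho>\<rfloor>
                           + d * step (1 - \<alpha>) (frac (real (Suc n) * \<rho>))))"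

definition a_fun :: "real \<Rightarrow> real \<Rightarrow> real \<Rightarrow> real \<Rightarrow> real \<Rightarrow> real" where
  "a_fun lam d \<delta> \<rho> \<alpha> =
     \<delta> / (1 - lam) + 1 / lam *
       (\<Sum>n. lam ^ Suc n * ((1 - lam) * real_of_int \<lfloor>\<alpha> - real (Suc n) * \<rho>\<rfloor>
                           + d * step \<alpha> (frac (\<alpha> - real (Suc n) * \<rho>))))"

definition delta_left :: "real \<Rightarrow> real \<Rightarrow> real \<Rightarrow> real \<Rightarrow> real" where
  "delta_left lam d \<rho> \<alpha> = Lim (at_left \<rho>) (\<lambda>r. delta_fun lam d r \<alpha>)"

definition a_right :: "real \<Rightarrow> real \<Rightarrow> real \<Rightarrow> real \<Rightarrow> real \<Rightarrow> real" where
  "a_right lam d \<delta> \<rho> \<alpha> = Lim (at_right \<rho>) (\<lambda>r. a_fun lam d \<delta> r \<alpha>)"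

text \<open>
  The series converge, and both functions are monotone in \<open>\<rho>\<close>; hence the two one-sided
  limits exist and the uses of \<^const>\<open>Lim\<close> above are meaningful.
\<close>

lemma floor_step_mono:
  assumes "0 \<le> d" "d \<le> 1 - lam" "x \<le> y"
  shows "(1 - lam) * real_of_int \<lfloor>x\<rfloor> + d * step c (frac x)
       \<le> (1 - lam) * real_of_int \<lfloor>y\<rfloor> + d * step c (frac y)"
proof (cases "\<lfloor>x\<rfloor> = \<lfloor>y\<rfloor>")
  case True
  with assms show ?thesis by (auto simp: step_def frac_def)
next
  case False
  with floor_mono[OF assms(3)] have "real_of_int \<lfloor>x\<rfloor> + 1 \<le> real_of_int \<lfloor>y\<rfloor>" by linarith
  then have "(1 - lam) * (real_of_int \<lfloor>x\<rfloor> + 1) \<le> (1 - lam) * real_of_int \<lfloor>y\<rfloor>"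
    using assms by (intro mult_left_mono) auto
  moreover have "d * step c (frac x) \<le> 1 - lam" "0 \<le> d * step c (frac y)"
    using assms by (auto simp: step_def)
  ultimately show ?thesis by (simp add: algebra_simps)
qed

lemma summable_floor_step:
  assumes lam: "0 < lam" "lam < 1" and d: "0 \<le> d" "d \<le> 1 - lam"
  shows "summable (\<lambda>n. lam ^ Suc n * ((1 - lam) * real_of_int \<lfloor>b + real (Suc n) * r\<rfloor>
                                     + d * step c (frac (b + real (Suc n) * r))))"
proof (rule summable_comparison_test')
  have "summable (\<lambda>n. real (Suc n) * lam ^ n)"
    using geometric_deriv_sums[of lam] lam by (simp add: sums_iff)
  then have "summable (\<lambda>n. (\<bar>b\<bar> + 2) * lam ^ n + \<bar>r\<bar> * (real (Suc n) * lam ^ n))"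
    using lam by (intro summable_add summable_mult summable_geometric) auto
  then show "summable (\<lambda>n. (\<bar>b\<bar> + 2 + \<bar>r\<bar> * real (Suc n)) * lam ^ n)"
    by (simp add: algebra_simps)
next
  fix n :: nat
  let ?x = "b + real (Suc n) * r"
  have "\<bar>(1 - lam) * real_of_int \<lfloor>?x\<rfloor>\<bar> \<le> 1 * \<bar>real_of_int \<lfloor>?x\<rfloor>\<bar>"
    using lam unfolding abs_mult by (intro mult_right_mono) auto
  also have "\<dots> \<le> \<bar>?x\<bar> + 1" by linarith
  finally have 1: "\<bar>(1 - lam) * real_of_int \<lfloor>?x\<rfloor>\<bar> \<le> \<bar>?x\<bar> + 1" .
  have 2: "\<bar>d * step c (frac ?x)\<bar> \<le> 1" using lam d by (auto simp: step_def)
  have 3: "\<bar>?x\<bar> \<le> \<bar>b\<bar> + \<bar>r\<bar> * real (Suc n)"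
    using abs_triangle_ineq[of b "real (Suc n) * r"] by (simp add: abs_mult mult.commute)
  have "lam ^ Suc n \<le> lam ^ n" using lam by (simp add: mult_left_le_one_le)
  with 1 2 3 lam
  have "lam ^ Suc n * \<bar>(1 - lam) * real_of_int \<lfloor>?x\<rfloor> + d * step c (frac ?x)\<bar>
     \<le> lam ^ n * (\<bar>b\<bar> + 2 + \<bar>r\<bar> * real (Suc n))"
    by (intro mult_mono) auto
  then show "norm (lam ^ Suc n * ((1 - lam) * real_of_int \<lfloor>?x\<rfloor> + d * step c (frac ?x)))
     \<le> (\<bar>b\<bar> + 2 + \<bar>r\<bar> * real (Suc n)) * lam ^ n"
    using lam by (simp add: abs_mult mult.commute)
qed

lemma delta_fun_mono:
  assumes "0 < lam" "lam < 1" "0 \<le> d" "d \<le> 1 - lam" "r \<le> s"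
  shows "delta_fun lam d r \<alpha> \<le> delta_fun lam d s \<alpha>"
  unfolding delta_fun_def
  using summable_floor_step[OF assms(1-4), of 0] assms
  by (intro add_left_mono mult_left_mono suminf_le floor_step_mono) auto

lemma a_fun_antimono:
  assumes "0 < lam" "lam < 1" "0 \<le> d" "d \<le> 1 - lam" "r \<le> s"
  shows "a_fun lam d \<delta> s \<alpha> \<le> a_fun lam d \<delta> r \<alpha>"
  unfolding a_fun_def
  using summable_floor_step[OF assms(1-4), of \<alpha> "- r"]
    summable_floor_step[OF assms(1-4), of \<alpha> "- s"] assms
  by (intro add_left_mono mult_left_mono suminf_le floor_step_mono) auto

lemma tendsto_delta_left:
  assumes "0 < lam" "lam < 1" "0 \<le> d" "d \<le> 1 - lam"
  shows "((\<lambda>r. delta_fun lam d r \<alpha>) \<longlongrightarrow> delta_left lam d \<rho> \<alpha>) (at_left \<rho>)"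
proof -
  have "((\<lambda>r. delta_fun lam d r \<alpha>) \<longlongrightarrow> Sup ((\<lambda>r. delta_fun lam d r \<alpha>) ` ({..<\<rho>} \<inter> UNIV)))
      (at \<rho> within ({..<\<rho>} \<inter> UNIV))"
    by (rule Lim_left_bound[where K = "delta_fun lam d \<rho> \<alpha>"])
       (auto intro: delta_fun_mono[OF assms])
  then show ?thesis
    unfolding delta_left_def by (auto simp: tendsto_Lim)
qed

lemma tendsto_a_right:
  assumes "0 < lam" "lam < 1" "0 \<le> d" "d \<le> 1 - lam"
  shows "((\<lambda>r. a_fun lam d \<delta> r \<alpha>) \<longlongrightarrow> a_right lam d \<delta> \<rho> \<alpha>) (at_right \<rho>)"
proof -
  have "((\<lambda>r. - a_fun lam d \<delta> r \<alpha>) \<longlongrightarrow> Inf ((\<lambda>r. - a_fun lam d \<delta> r \<alpha>) ` ({\<rho><..} \<inter> UNIV)))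
      (at \<rho> within ({\<rho><..} \<inter> UNIV))"
    by (rule Lim_right_bound[where K = "- a_fun lam d \<delta> \<rho> \<alpha>"])
       (auto intro: a_fun_antimono[OF assms])
  from tendsto_minus[OF this] show ?thesis
    unfolding a_right_def by (auto simp: tendsto_Lim)
qed

end

theory Submission
  imports Defs
begin

text \<open>
  In terms of the integer parts, \<open>(1 - lam) \<lfloor>x\<rfloor> + d \<theta>\<^sub>c({x}) = (1 - lam - d) \<lfloor>x\<rfloor> + d \<lfloor>x - c\<rfloor> + d\<close>
  for \<open>c \<in> [0,1]\<close>. Hence \<open>\<delta>(\<rho>,\<alpha>)\<close> and \<open>a(\<delta>,\<rho>,\<alpha>)\<close> are affine in sums
  \<open>\<Sum> lam\<^sup>k \<lfloor>\<beta> + kt\<rfloor>\<close>, whose left limits in \<open>t\<close> replace the integer part by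
  \<open>\<lceil>\<cdot>\<rceil> - 1\<close> (Tannery), so the jumps are the sums of those \<open>lam\<^sup>k\<close> with \<open>\<beta> + kt \<in> \<int>\<close>.

  For the rotation number, let \<open>\<phi>\<close> solve \<open>\<phi>(y + \<rho>) = lam \<phi>(y) + \<delta> + (1 - lam) \<lfloor>y\<rfloor> + d \<theta>\<^sub>\<alpha>({y})\<close>;
  it is nondecreasing with \<open>\<phi>(y + 1) = \<phi>(y) + 1\<close>. One finds
  \<open>(1 - lam) \<phi>(0) = \<delta> - \<delta>(\<rho>\<^sup>-,\<alpha>)\<close>, \<open>\<phi>(\<alpha>) = a(\<delta>,\<rho>,\<alpha>)\<close>, and for the left limits
  \<open>(1 - lam) \<phi>(0\<^sup>-) = \<delta> - \<delta>(\<rho>,\<alpha>)\<close>, \<open>\<phi>(\<alpha>\<^sup>-) = a(\<delta>,\<rho>\<^sup>+,\<alpha>)\<close>. The hypotheses therefore say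
  exactly that the jumps of \<open>\<phi>\<close> at \<open>0\<close> and \<open>\<alpha>\<close> cover \<open>0\<close> and \<open>a\<close>, and this is what is needed for
  \<open>\<phi>(y + \<rho>) \<le> F(\<phi>(y))\<close> and for \<open>x < \<phi>(y\<^sup>-) \<Longrightarrow> F(x) < \<phi>((y + \<rho>)\<^sup>-)\<close>. Orbits of \<open>F\<close> are thus
  trapped between two orbits of the rotation by \<open>\<rho>\<close>. The inclusions in \<open>[0,1]\<close> follow from the
  monotonicity of \<open>\<phi>\<close>.
\<close>

section \<open>Floor series, ceiling series and weighted integer hits\<close>

definition floor_series :: "real \<Rightarrow> real \<Rightarrow> real \<Rightarrow> real" where
  "floor_series lam t \<beta> = (\<Sum>n. lam ^ Suc n * real_of_int \<lfloor>\<beta> + real (Suc n) * t\<rfloor>)"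

definition ceiling_series :: "real \<Rightarrow> real \<Rightarrow> real \<Rightarrow> real" where
  "ceiling_series lam t \<beta> = (\<Sum>n. lam ^ Suc n * (real_of_int \<lceil>\<beta> + real (Suc n) * t\<rceil> - 1))"

definition integer_hits :: "real \<Rightarrow> real \<Rightarrow> real \<Rightarrow> real" where
  "integer_hits lam t \<beta> = (\<Sum>n. lam ^ Suc n * of_bool (\<beta> + real (Suc n) * t \<in> \<int>))"

text \<open>Subtracting \<open>c\<close> from the interval [0,1] lowers the integer part by one
  exactly when \<open>frac x < c\<close>, endpoints included: never for c = 0, always for c = 1. The
  step thus turns into a second floor term.\<close>

lemma floor_step_conv:
  assumes "0 \<le> c" "c \<le> 1"
  shows "(1 - lam) * real_of_int \<lfloor>x\<rfloor> + d * step c (frac x)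
       = (1 - lam - d) * real_of_int \<lfloor>x\<rfloor> + d * real_of_int \<lfloor>x - c\<rfloor> + d"
proof -
  have "real_of_int \<lfloor>x - c\<rfloor> = real_of_int \<lfloor>x\<rfloor> + step c (frac x) - 1"
  proof (cases "frac x < c")
    case True
    then have "\<lfloor>x - c\<rfloor> = \<lfloor>x\<rfloor> - 1"
      using assms unfolding frac_def by linarith
    then show ?thesis using True by (simp add: step_def)
  next
    case False
    then have "\<lfloor>x - c\<rfloor> = \<lfloor>x\<rfloor>"
      using assms unfolding frac_def by linarith
    then show ?thesis using False by (simp add: step_def)
  qed
  then have "d * real_of_int \<lfloor>x - c\<rfloor> = d * (real_of_int \<lfloor>x\<rfloor> + step c (frac x) - 1)"
    by simp
  then show ?thesis by (simp add: algebra_simps)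
qed

context
  fixes lam :: real
  assumes lam: "0 < lam" "lam < 1"
begin

lemma power_Suc_sums: "(\<lambda>n. lam ^ Suc n) sums (lam / (1 - lam))"
  using sums_mult[OF geometric_sums[of lam], of lam] lam by simp

lemma summable_floor_series:
  "summable (\<lambda>n. lam ^ Suc n * real_of_int \<lfloor>\<beta> + real (Suc n) * t\<rfloor>)"
proof -
  \<comment> \<open>With d = 0 the step term disappears; the remaining factor 1 - lam is divided out
    afterwards.\<close>
  have "summable (\<lambda>n. lam ^ Suc n * ((1 - lam) * real_of_int \<lfloor>\<beta> + real (Suc n) * t\<rfloor>
          + 0 * step 0 (frac (\<beta> + real (Suc n) * t))))"
    using lam by (intro summable_floor_step) auto
  from summable_mult[OF this, of "1 / (1 - lam)"] lam show ?thesis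
    by (simp add: mult.left_commute[of _ "1 - lam"])
qed

lemma floor_series_sums:
  "(\<lambda>n. lam ^ Suc n * real_of_int \<lfloor>\<beta> + real (Suc n) * t\<rfloor>) sums floor_series lam t \<beta>"
  unfolding floor_series_def by (intro summable_sums summable_floor_series)

text \<open>The reflection \<lceil>x\<rceil> = - \<lfloor>-x\<rfloor> lets monotonicity, integer
  translation and the shift rule of ceiling series be read off from floor series at (-t, -\<beta>).
  The summand -1 contributes - lam / (1 - lam).\<close>

lemma ceiling_series_sums_aux:
  "(\<lambda>n. lam ^ Suc n * (real_of_int \<lceil>\<beta> + real (Suc n) * t\<rceil> - 1))
     sums (- floor_series lam (- t) (- \<beta>) - lam / (1 - lam))"
proof -
  have *: "- \<beta> + real (Suc n) * - t = - (\<beta> + real (Suc n) * t)" for n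
    by simp
  show ?thesis
    using sums_diff[OF sums_minus[OF floor_series_sums[of "- \<beta>" "- t"]] power_Suc_sums]
    unfolding * ceiling_def by (simp add: algebra_simps)
qed

lemma ceiling_series_eq:
  "ceiling_series lam t \<beta> = - floor_series lam (- t) (- \<beta>) - lam / (1 - lam)"
  unfolding ceiling_series_def by (rule sums_unique[OF ceiling_series_sums_aux, symmetric])

lemma ceiling_series_sums:
  "(\<lambda>n. lam ^ Suc n * (real_of_int \<lceil>\<beta> + real (Suc n) * t\<rceil> - 1)) sums ceiling_series lam t \<beta>"
  unfolding ceiling_series_eq by (rule ceiling_series_sums_aux)

text \<open>The difference \<lfloor>x\<rfloor> - (\<lceil>x\<rceil> - 1) is 1 at integers and 0
  elsewhere.\<close>

lemma integer_hits_sums_aux: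
  "(\<lambda>n. lam ^ Suc n * of_bool (\<beta> + real (Suc n) * t \<in> \<int>))
     sums (floor_series lam t \<beta> - ceiling_series lam t \<beta>)"
proof -
  have *: "of_bool (x \<in> \<int>) = real_of_int \<lfloor>x\<rfloor> - (real_of_int \<lceil>x\<rceil> - 1)" for x :: real
  proof (cases "x \<in> \<int>")
    case True
    then show ?thesis by (auto elim: Ints_cases)
  next
    case False
    then have "x \<noteq> of_int \<lfloor>x\<rfloor>" by (metis Ints_of_int)
    with False show ?thesis by (simp add: ceiling_altdef)
  qed
  show ?thesis
    using sums_diff[OF floor_series_sums ceiling_series_sums]
    unfolding * right_diff_distrib .
qed

lemma integer_hits_eq:
  "integer_hits lam t \<beta> = floor_series lam t \<beta> - ceiling_series lam t \<beta>"
  unfolding integer_hits_def by (rule sums_unique[OF integer_hits_sums_aux, symmetric])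

lemma summable_integer_hits:
  "summable (\<lambda>n. lam ^ Suc n * of_bool (\<beta> + real (Suc n) * t \<in> \<int>))"
  by (rule sums_summable[OF integer_hits_sums_aux])

lemma floor_series_mono: "x \<le> y \<Longrightarrow> floor_series lam t x \<le> floor_series lam t y"
  by (rule sums_le[OF _ floor_series_sums floor_series_sums])
     (use lam in \<open>intro mult_left_mono; simp add: floor_mono\<close>)

lemma ceiling_series_mono: "x \<le> y \<Longrightarrow> ceiling_series lam t x \<le> ceiling_series lam t y"
  by (simp add: ceiling_series_eq floor_series_mono)

text \<open>For x < y the integer part of x + kt lies strictly below y + kt. Later this compares a
  value of \<phi> with a left limit further to the right.\<close>

lemma floor_series_le_ceiling_series:
  assumes "x < y"
  shows "floor_series lam t x \<le> ceiling_series lam t y"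
proof (rule sums_le[OF _ floor_series_sums ceiling_series_sums])
  fix n
  have "\<lfloor>x + real (Suc n) * t\<rfloor> \<le> \<lceil>y + real (Suc n) * t\<rceil> - 1"
    using assms by linarith
  then have "real_of_int \<lfloor>x + real (Suc n) * t\<rfloor> \<le> real_of_int \<lceil>y + real (Suc n) * t\<rceil> - 1"
    by linarith
  then show "lam ^ Suc n * real_of_int \<lfloor>x + real (Suc n) * t\<rfloor>
      \<le> lam ^ Suc n * (real_of_int \<lceil>y + real (Suc n) * t\<rceil> - 1)"
    using lam by (intro mult_left_mono) auto
qed

lemma floor_series_add_int:
  "floor_series lam t (\<beta> + of_int m) = floor_series lam t \<beta> + of_int m * (lam / (1 - lam))"
proof -
  have *: "\<beta> + of_int m + real (Suc n) * t = \<beta> + real (Suc n) * t + of_int m" for n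
    by simp
  have "(\<lambda>n. lam ^ Suc n * real_of_int \<lfloor>\<beta> + of_int m + real (Suc n) * t\<rfloor>)
      sums (floor_series lam t \<beta> + of_int m * (lam / (1 - lam)))"
    using sums_add[OF floor_series_sums[of \<beta> t] sums_mult[OF power_Suc_sums, of "of_int m"]]
    unfolding * floor_add_int[symmetric] by (simp add: algebra_simps)
  from sums_unique2[OF floor_series_sums this] show ?thesis .
qed

lemma ceiling_series_add_int:
  "ceiling_series lam t (\<beta> + of_int m) = ceiling_series lam t \<beta> + of_int m * (lam / (1 - lam))"
  using floor_series_add_int[of "- t" "- \<beta>" "- m"] by (simp add: ceiling_series_eq)

lemma integer_hits_add_int: "integer_hits lam t (\<beta> + of_int m) = integer_hits lam t \<beta>"
  by (simp add: integer_hits_eq floor_series_add_int ceiling_series_add_int)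

text \<open>At \<beta> - t the term k = 1 is lam \<lfloor>\<beta>\<rfloor>, and the later terms are
  lam times the series at \<beta>. This recurrence is the source of the functional equation of
  \<phi>.\<close>

lemma floor_series_shift:
  "floor_series lam t (\<beta> - t) = lam * (real_of_int \<lfloor>\<beta>\<rfloor> + floor_series lam t \<beta>)"
proof -
  have *: "\<beta> - t + real (Suc (Suc n)) * t = \<beta> + real (Suc n) * t" for n
    by (simp add: algebra_simps)
  have "floor_series lam t (\<beta> - t)
      = (\<Sum>n. lam ^ Suc (Suc n) * real_of_int \<lfloor>\<beta> - t + real (Suc (Suc n)) * t\<rfloor>)
        + lam * real_of_int \<lfloor>\<beta>\<rfloor>"
    unfolding floor_series_def
    using suminf_split_head[OF summable_floor_series[of "\<beta> - t" t]] by simp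
  also have "\<dots> = lam * floor_series lam t \<beta> + lam * real_of_int \<lfloor>\<beta>\<rfloor>"
    using suminf_mult[OF summable_floor_series[of \<beta> t], of lam]
    unfolding * floor_series_def by (simp add: mult.assoc)
  finally show ?thesis by (simp add: algebra_simps)
qed

lemma ceiling_series_shift:
  "ceiling_series lam t (\<beta> - t) = lam * (real_of_int \<lceil>\<beta>\<rceil> - 1 + ceiling_series lam t \<beta>)"
  using floor_series_shift[of "- t" "- \<beta>"] lam
  by (simp add: ceiling_series_eq ceiling_def field_simps)

text \<open>The k-th integer part grows by k, and the sum of k lam^k is lam / (1 - lam)^2.\<close>

lemma floor_series_add_one:
  "floor_series lam (t + 1) \<beta> = floor_series lam t \<beta> + lam / (1 - lam)\<^sup>2"
proof -
  have *: "\<beta> + real (Suc n) * (t + 1) = \<beta> + real (Suc n) * t + of_int (int (Suc n))" for n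
    by (simp add: algebra_simps)
  have "(\<lambda>n. real (Suc n) * lam ^ n) sums (1 / (1 - lam)\<^sup>2)"
    using geometric_deriv_sums[of lam] lam by simp
  from sums_mult[OF this, of lam]
  have "(\<lambda>n. lam ^ Suc n * real_of_int (int (Suc n))) sums (lam / (1 - lam)\<^sup>2)"
    by (simp add: algebra_simps)
  from sums_add[OF floor_series_sums[of \<beta> t] this]
  have "(\<lambda>n. lam ^ Suc n * real_of_int \<lfloor>\<beta> + real (Suc n) * (t + 1)\<rfloor>)
      sums (floor_series lam t \<beta> + lam / (1 - lam)\<^sup>2)"
    unfolding * floor_add_int[symmetric] by (simp add: algebra_simps)
  from sums_unique2[OF floor_series_sums this] show ?thesis .
qed

lemma ceiling_series_pos:
  assumes "0 < t"
  shows "0 < ceiling_series lam t 0"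
proof -
  obtain N where N: "1 < real N * t" 
    using assms reals_Archimedean3 by blast
  \<comment> \<open>The summand with index N belongs to k = N + 1, so the bound is needed for
    \<open>Suc N\<close>.\<close>
  then have N': "1 < real (Suc N) * t" 
    using assms by (simp add: algebra_simps)
  have nonneg: "0 \<le> real_of_int \<lceil>0 + real (Suc n) * t\<rceil> - 1" for n
  proof -
    have "0 < \<lceil>0 + real (Suc n) * t\<rceil>" using assms by simp
    then show ?thesis by linarith
  qed
  have pos: "0 < real_of_int \<lceil>0 + real (Suc N) * t\<rceil> - 1"
    using N' by linarith
  have "0 < (\<Sum>n. lam ^ Suc n * (real_of_int \<lceil>0 + real (Suc n) * t\<rceil> - 1))"
    using lam
    by (intro suminf_pos2[of _ N] sums_summable[OF ceiling_series_sums] mult_nonneg_nonneg nonneg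
          mult_pos_pos pos) auto
  then show ?thesis by (simp only: ceiling_series_def)
qed

text \<open>Writing t = -(1 - t) + 1 and reflecting leaves the bound minus the ceiling series at 1 -
  t, which is positive. The bound is the sum of (k - 1) lam^k, the left limit at t = 1.\<close>

lemma floor_series_less:
  assumes "t < 1"
  shows "floor_series lam t 0 < (lam / (1 - lam))\<^sup>2"
proof -
  have "floor_series lam t 0 = floor_series lam (- (1 - t) + 1) 0"
    by simp
  also have "\<dots> = lam / (1 - lam)\<^sup>2 - lam / (1 - lam) - ceiling_series lam (1 - t) 0"
    unfolding floor_series_add_one ceiling_series_eq by simp
  also have "lam / (1 - lam)\<^sup>2 - lam / (1 - lam) = (lam / (1 - lam))\<^sup>2"
    using lam by (simp add: divide_simps power2_eq_square) (simp add: algebra_simps)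
  finally show ?thesis
    using ceiling_series_pos[of "1 - t"] assms by simp
qed

section \<open>Arithmetic of integer hits, mainly for rational frequencies\<close>

lemma integer_hits_nonneg: "0 \<le> integer_hits lam t \<beta>"
  unfolding integer_hits_def using lam
  by (intro suminf_nonneg summable_integer_hits) auto

lemma integer_hits_eq_0_iff:
  "integer_hits lam t \<beta> = 0 \<longleftrightarrow> (\<forall>n>0. \<beta> + real n * t \<notin> \<int>)"
proof -
  have "integer_hits lam t \<beta> = 0 \<longleftrightarrow> (\<forall>n. \<beta> + real (Suc n) * t \<notin> \<int>)"
    unfolding integer_hits_def using lam
    by (subst suminf_eq_zero_iff[OF summable_integer_hits]) auto
  then show ?thesis by (metis gr0_conv_Suc)
qed

lemma integer_hits_uminus: "integer_hits lam (- t) (- \<beta>) = integer_hits lam t \<beta>"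
  by (simp add: integer_hits_eq ceiling_series_eq)

text \<open>By coprimality the hits are the multiples of q. Among the first q terms only the last
  contributes, and shifting the index by q gives J = lam^q + lam^q J.\<close>

lemma integer_hits_rational:
  fixes p q :: nat
  assumes "0 < q" "coprime p q"
  shows "integer_hits lam (real p / real q) 0 = lam ^ q / (1 - lam ^ q)"
proof -
  have int_iff: "0 + real n * (real p / real q) \<in> \<int> \<longleftrightarrow> q dvd n" for n
  proof -
    have "real n * (real p / real q) \<in> \<int> \<longleftrightarrow> q dvd n * p"
      using of_int_div_of_int_in_Ints_iff[of "int (n * p)" "int q", where 'a = real] assms
      by (simp flip: of_nat_mult)
    then show ?thesis
      using assms by (simp add: coprime_dvd_mult_left_iff coprime_commute)
  qed
  define J where "J = (\<Sum>n. lam ^ Suc n * of_bool (q dvd Suc n))"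
  have summ: "summable (\<lambda>n. lam ^ Suc n * of_bool (q dvd Suc n))"
    using summable_integer_hits[of 0 "real p / real q"] unfolding int_iff .
  have J: "integer_hits lam (real p / real q) 0 = J"
    unfolding integer_hits_def int_iff J_def ..
  have "(\<Sum>n<q. lam ^ Suc n * of_bool (q dvd Suc n)) = (\<Sum>n<q. if n = q - 1 then lam ^ q else 0)"
  proof (rule sum.cong)
    fix n assume n: "n \<in> {..<q}"
    have "q dvd Suc n \<longleftrightarrow> n = q - 1"
      using n assms(1) by (auto dest!: dvd_imp_le)
    then show "lam ^ Suc n * of_bool (q dvd Suc n) = (if n = q - 1 then lam ^ q else 0)"
      using assms(1) by (simp flip: power_Suc)
  qed simp
  also have "\<dots> = lam ^ q" using assms(1) by simp
  finally have "J = (\<Sum>n. lam ^ Suc (n + q) * of_bool (q dvd Suc (n + q))) + lam ^ q"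
    unfolding J_def by (subst suminf_split_initial_segment[OF summ, of q]) simp
  also have "(\<Sum>n. lam ^ Suc (n + q) * of_bool (q dvd Suc (n + q)))
      = (\<Sum>n. lam ^ q * (lam ^ Suc n * of_bool (q dvd Suc n)))"
  proof (intro suminf_cong)
    fix n
    have "q dvd Suc (n + q) \<longleftrightarrow> q dvd Suc n"
      using dvd_add_triv_right_iff[of q "Suc n"] by simp
    then show "lam ^ Suc (n + q) * of_bool (q dvd Suc (n + q))
        = lam ^ q * (lam ^ Suc n * of_bool (q dvd Suc n))"
      by (simp add: power_add mult_ac)
  qed
  also have "\<dots> = lam ^ q * J"
    unfolding J_def by (rule suminf_mult[OF summ])
  finally have "J * (1 - lam ^ q) = lam ^ q" by (simp add: algebra_simps)
  moreover have "lam ^ q < 1" using lam assms(1) by (simp add: power_less_one_iff)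
  ultimately show ?thesis unfolding J by (simp add: field_simps)
qed

text \<open>Modulo 1, multiplying np/q by q - 1 changes its sign, so a hit of -\<beta> at n would
  give a hit of \<beta> at (q - 1) n.\<close>

lemma integer_hits_rational_uminus_eq_0:
  fixes p q :: nat
  assumes "1 < q" "integer_hits lam (real p / real q) \<beta> = 0"
  shows "integer_hits lam (real p / real q) (- \<beta>) = 0"
  unfolding integer_hits_eq_0_iff
proof (intro allI impI)
  fix n :: nat assume n: "n > 0"
  have "real ((q - 1) * n) * (real p / real q) = real (n * p) - real n * (real p / real q)"
    using assms(1) by (simp add: of_nat_diff field_simps)
  then have "\<beta> + real ((q - 1) * n) * (real p / real q)
      = real (n * p) - (- \<beta> + real n * (real p / real q))"
    by simp
  moreover have "\<beta> + real ((q - 1) * n) * (real p / real q) \<notin> \<int>"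
    using iffD1[OF integer_hits_eq_0_iff assms(2), rule_format, of "(q - 1) * n"] assms(1) n
    by simp
  ultimately show "- \<beta> + real n * (real p / real q) \<notin> \<int>"
    using Ints_diff[OF Ints_of_nat] by metis
qed

text \<open>Modulo 1, np/q depends only on n mod q, and the residue 0 never hits because \<beta> is
  not an integer.\<close>

lemma integer_hits_rational_eq_0_iff:
  fixes p q :: nat
  assumes "1 < q" "\<beta> \<notin> \<int>"
  shows "integer_hits lam (real p / real q) (- \<beta>) = 0
     \<longleftrightarrow> (\<forall>r\<in>{1..q - 1}. real (r * p) / real q - \<beta> \<notin> \<int>)"
  unfolding integer_hits_eq_0_iff
proof (intro iffI ballI allI impI)
  fix r assume *: "\<forall>n>0. - \<beta> + real n * (real p / real q) \<notin> \<int>" and r: "r \<in> {1..q - 1}"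
  then show "real (r * p) / real q - \<beta> \<notin> \<int>"
    using *[rule_format, of r] by simp
next
  fix n :: nat assume *: "\<forall>r\<in>{1..q - 1}. real (r * p) / real q - \<beta> \<notin> \<int>" and n: "n > 0"
  have "real n = real (n div q) * real q + real (n mod q)"
    by (simp flip: of_nat_mult of_nat_add)
  then have "real n * (real p / real q)
      = (real (n div q) * real q + real (n mod q)) * (real p / real q)" by simp
  also have "\<dots> = real (n div q * p) + real (n mod q * p) / real q"
    using assms(1) by (simp add: distrib_right add_divide_distrib)
  finally have eq: "- \<beta> + real n * (real p / real q)
      = real (n div q * p) + (real (n mod q * p) / real q - \<beta>)" by simp
  have "real (n mod q * p) / real q - \<beta> \<notin> \<int>"
  proof (cases "n mod q = 0")
    case True
    then show ?thesis using assms(2) by simp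
  next
    case False
    moreover have "n mod q < q" using assms(1) by simp
    ultimately have "n mod q \<in> {1..q - 1}" by simp
    then show ?thesis using * by simp
  qed
  moreover have "x \<in> \<int>" if "real m + x \<in> \<int>" for m x
    using Ints_diff[OF that Ints_of_nat[of m]] by simp
  ultimately show "- \<beta> + real n * (real p / real q) \<notin> \<int>" unfolding eq by metis
qed

text \<open>For \<alpha> in {0,1} integer translation reduces to \<beta> = 0, where the count is
  known and no r < q resonates. Otherwise the bound is 0 and equality means absence of hits. Both
  signs are treated because the jump of \<delta> involves \<alpha> and that of a involves
  -\<alpha>.\<close>

lemma integer_hits_rational_ge:
  fixes p q :: nat
  assumes pq: "0 < p" "p < q" "coprime p q" and \<alpha>: "0 \<le> \<alpha>" "\<alpha> \<le> 1" and \<beta>: "\<beta> = \<alpha> \<or> \<beta> = - \<alpha>"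
  shows "indicator {0, 1} \<alpha> * (lam ^ q / (1 - lam ^ q)) \<le> integer_hits lam (real p / real q) \<beta>"
    and "integer_hits lam (real p / real q) \<beta> = indicator {0, 1} \<alpha> * (lam ^ q / (1 - lam ^ q))
      \<longleftrightarrow> (\<forall>r\<in>{1..q - 1}. real (r * p) / real q - \<alpha> \<notin> \<int>)"
proof -
  let ?J = "integer_hits lam (real p / real q)" and ?c = "lam ^ q / (1 - lam ^ q)"
  let ?N = "\<forall>r\<in>{1..q - 1}. real (r * p) / real q - \<alpha> \<notin> \<int>"
  have J0: "?J 0 = ?c" using pq by (intro integer_hits_rational) auto
  have "indicator {0, 1} \<alpha> * ?c \<le> ?J \<beta> \<and> (?J \<beta> = indicator {0, 1} \<alpha> * ?c \<longleftrightarrow> ?N)"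
  proof (cases "\<alpha> \<in> {0, 1}")
    case True
    have "?J 1 = ?J 0" "?J (- 1) = ?J 0"
      using integer_hits_add_int[of "real p / real q" 0 1]
        integer_hits_add_int[of "real p / real q" 0 "- 1"] by simp_all
    then have "?J \<beta> = ?c" using True \<beta> J0 by auto
    moreover have ?N
    proof
      fix r assume r: "r \<in> {1..q - 1}"
      have "real (r * p) / real q \<notin> \<int>"
      proof
        assume "real (r * p) / real q \<in> \<int>"
        then have "q dvd r * p"
          using of_int_div_of_int_in_Ints_iff[of "int (r * p)" "int q", where 'a = real] pq
          by (simp flip: of_nat_mult)
        then have "q dvd r"
          using pq by (simp add: coprime_dvd_mult_left_iff coprime_commute)
        then show False using r by (auto dest!: dvd_imp_le)
      qed
      moreover have "\<alpha> \<in> \<int>" using True by auto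
      moreover have "x \<in> \<int>" if "x - \<alpha> \<in> \<int>" "\<alpha> \<in> \<int>" for x
        using Ints_add[OF that] by simp
      ultimately show "real (r * p) / real q - \<alpha> \<notin> \<int>" by metis
    qed
    moreover have "indicator {0, 1} \<alpha> = (1 :: real)" using True by simp
    ultimately show ?thesis by simp
  next
    case False
    have "\<alpha> \<notin> \<int>"
    proof
      assume "\<alpha> \<in> \<int>"
      then obtain m where "\<alpha> = of_int m" by (elim Ints_cases)
      with \<alpha> False show False by auto
    qed
    moreover have "?J \<beta> = 0 \<longleftrightarrow> ?J (- \<alpha>) = 0"
      using \<beta> integer_hits_rational_uminus_eq_0[of q p \<alpha>]
        integer_hits_rational_uminus_eq_0[of q p "- \<alpha>"] pq by auto
    moreover have "indicator {0, 1} \<alpha> = (0 :: real)" using False by simp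
    ultimately show ?thesis
      using integer_hits_rational_eq_0_iff[of q \<alpha> p] integer_hits_nonneg pq by simp
  qed
  then show "indicator {0, 1} \<alpha> * ?c \<le> ?J \<beta>"
    and "?J \<beta> = indicator {0, 1} \<alpha> * ?c \<longleftrightarrow> ?N" by blast+
qed

text \<open>Each term is constant once \<beta> + kr lies between \<lceil>\<beta> + kt\<rceil> - 1
  and \<beta> + kt. How close r must be to t depends on k, so a summable bound that is uniform in r
  has to justify the exchange of limit and sum.\<close>

lemma tendsto_floor_series_left:
  "((\<lambda>r. floor_series lam r \<beta>) \<longlongrightarrow> ceiling_series lam t \<beta>) (at_left t)"
proof -
  \<comment> \<open>On (t - 1, t) one has |r| \<le> |t| + 1, and taking the integer part costs at
    most 1.\<close>
  define M where "M = (\<lambda>n. lam ^ Suc n * (\<bar>\<beta>\<bar> + 1 + real (Suc n) * (\<bar>t\<bar> + 1)))"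
  have lim: "((\<lambda>r. lam ^ Suc n * real_of_int \<lfloor>\<beta> + real (Suc n) * r\<rfloor>)
      \<longlongrightarrow> lam ^ Suc n * (real_of_int \<lceil>\<beta> + real (Suc n) * t\<rceil> - 1)) (at_left t)" for n
  proof (rule tendsto_eventually)
    let ?m = "\<lceil>\<beta> + real (Suc n) * t\<rceil> - 1"
    have "((\<lambda>r. \<beta> + real (Suc n) * r) \<longlongrightarrow> \<beta> + real (Suc n) * t) (at_left t)"
      by (intro tendsto_intros)
    moreover have "real_of_int ?m < \<beta> + real (Suc n) * t" by linarith
    ultimately have "\<forall>\<^sub>F r in at_left t. real_of_int ?m < \<beta> + real (Suc n) * r"
      by (rule order_tendstoD)
    moreover have "\<forall>\<^sub>F r in at_left t. r < t"
      by (simp add: eventually_at_filter)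
    ultimately show "\<forall>\<^sub>F r in at_left t. lam ^ Suc n * real_of_int \<lfloor>\<beta> + real (Suc n) * r\<rfloor>
        = lam ^ Suc n * (real_of_int \<lceil>\<beta> + real (Suc n) * t\<rceil> - 1)"
    proof eventually_elim
      case (elim r)
      have "\<beta> + real (Suc n) * r < \<beta> + real (Suc n) * t" using elim by simp
      then have "\<lfloor>\<beta> + real (Suc n) * r\<rfloor> = ?m" using elim(1) by linarith
      then show ?case by simp
    qed
  qed
  have bound_aux: "norm (lam ^ Suc n * real_of_int \<lfloor>\<beta> + real (Suc n) * r\<rfloor>) \<le> M n"
    if r: "r \<in> {t - 1<..<t}" for n r
  proof -
    have "\<bar>r\<bar> \<le> \<bar>t\<bar> + 1" using r by auto
    then have "real (Suc n) * \<bar>r\<bar> \<le> real (Suc n) * (\<bar>t\<bar> + 1)"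
      by (intro mult_left_mono) auto
    moreover have "\<bar>real (Suc n) * r\<bar> = real (Suc n) * \<bar>r\<bar>" by (simp add: abs_mult)
    ultimately have "\<bar>real_of_int \<lfloor>\<beta> + real (Suc n) * r\<rfloor>\<bar> \<le> \<bar>\<beta>\<bar> + 1 + real (Suc n) * (\<bar>t\<bar> + 1)"
      by linarith
    then show ?thesis
      using lam unfolding M_def by (simp add: abs_mult mult_left_mono)
  qed
  have "\<forall>\<^sub>F r in at_left t. r \<in> {t - 1<..<t}"
    by (rule eventually_at_left_real) simp
  from eventually_prodI[OF eventually_True[of "at_top :: nat filter"] this]
  have bound: "\<forall>\<^sub>F (n, r) in at_top \<times>\<^sub>F at_left t.
      norm (lam ^ Suc n * real_of_int \<lfloor>\<beta> + real (Suc n) * r\<rfloor>) \<le> M n"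
    by (rule eventually_mono) (auto simp del: power_Suc of_nat_Suc real_norm_def intro!: bound_aux)
  have "summable (\<lambda>n. real (Suc n) * lam ^ n)"
    using geometric_deriv_sums[of lam] lam by (simp add: sums_iff)
  then have "summable (\<lambda>n. (\<bar>\<beta>\<bar> + 1) * lam ^ Suc n + ((\<bar>t\<bar> + 1) * lam) * (real (Suc n) * lam ^ n))"
    using sums_summable[OF power_Suc_sums] by (intro summable_add summable_mult)
  also have "(\<lambda>n. (\<bar>\<beta>\<bar> + 1) * lam ^ Suc n + ((\<bar>t\<bar> + 1) * lam) * (real (Suc n) * lam ^ n)) = M"
    unfolding M_def by (rule ext) (simp add: algebra_simps)
  finally have M: "summable M" .
  show ?thesis
    using tannerys_theorem[OF lim bound M]
    unfolding floor_series_def ceiling_series_def by simp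
qed

end

text \<open>This is the \<phi> of the overview: iterating its functional equation backwards along y
  - k\<rho> gives the series, with frequency -\<rho>. The constants \<delta> + d sum to the first
  summand, and the division by \<open>lam\<close> accounts for weights lam^(k-1).\<close>

definition semiconj :: "real \<Rightarrow> real \<Rightarrow> real \<Rightarrow> real \<Rightarrow> real \<Rightarrow> real \<Rightarrow> real" where
  "semiconj lam d \<delta> \<rho> \<alpha> y = (\<delta> + d) / (1 - lam) +
     ((1 - lam - d) * floor_series lam (- \<rho>) y + d * floor_series lam (- \<rho>) (y - \<alpha>)) / lam"

text \<open>The left limit of \<^const>\<open>semiconj\<close> in \<open>y\<close>.\<close>

definition semiconj_left :: "real \<Rightarrow> real \<Rightarrow> real \<Rightarrow> real \<Rightarrow> real \<Rightarrow> real \<Rightarrow> real" where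
  "semiconj_left lam d \<delta> \<rho> \<alpha> y = (\<delta> + d) / (1 - lam) +
     ((1 - lam - d) * ceiling_series lam (- \<rho>) y + d * ceiling_series lam (- \<rho>) (y - \<alpha>)) / lam"

lemma mem_image_add_Ints_iff: "x \<in> (\<lambda>z. z + c) ` \<int> \<longleftrightarrow> x - c \<in> \<int>" for x c :: real
  by (auto simp: image_iff) (metis diff_add_cancel)

section \<open>Closed forms of the parameter functions and their one-sided limits\<close>

context
  fixes lam d \<alpha> :: real
  assumes lam: "0 < lam" "lam < 1" and d: "0 < d" "d < 1 - lam" and \<alpha>: "0 \<le> \<alpha>" "\<alpha> \<le> 1"
begin

text \<open>For c = 1 - \<alpha> the second floor is \<lfloor>\<alpha> + k\<rho>\<rfloor> - 1, and
  this -1 cancels the constant d of \<open>floor_step_conv\<close>.\<close>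

lemma delta_fun_eq:
  "delta_fun lam d \<rho> \<alpha> = 1 - lam - d + (1 - lam) / lam *
     ((1 - lam - d) * floor_series lam \<rho> 0 + d * floor_series lam \<rho> \<alpha>)"
proof -
  let ?x = "\<lambda>n. real (Suc n) * \<rho>"
  have eq: "lam ^ Suc n * ((1 - lam) * real_of_int \<lfloor>?x n\<rfloor> + d * step (1 - \<alpha>) (frac (?x n)))
      = (1 - lam - d) * (lam ^ Suc n * real_of_int \<lfloor>0 + ?x n\<rfloor>)
        + d * (lam ^ Suc n * real_of_int \<lfloor>\<alpha> + ?x n\<rfloor>)" for n
  proof -
    have "\<lfloor>?x n - (1 - \<alpha>)\<rfloor> = \<lfloor>\<alpha> + ?x n\<rfloor> - 1" by linarith
    then have "(1 - lam) * real_of_int \<lfloor>?x n\<rfloor> + d * step (1 - \<alpha>) (frac (?x n))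
        = (1 - lam - d) * real_of_int \<lfloor>0 + ?x n\<rfloor> + d * real_of_int \<lfloor>\<alpha> + ?x n\<rfloor>"
      using floor_step_conv[of "1 - \<alpha>" lam "?x n" d] \<alpha>
      by (simp add: right_diff_distrib del: of_nat_Suc)
    then show ?thesis by (simp only: distrib_left mult_ac)
  qed
  show ?thesis
    unfolding delta_fun_def eq
    using sums_unique[OF sums_add[OF
        sums_mult[OF floor_series_sums[OF lam, of 0 \<rho>], of "1 - lam - d"]
        sums_mult[OF floor_series_sums[OF lam, of \<alpha> \<rho>], of d]]]
    by simp
qed

text \<open>Here the constant d of \<open>floor_step_conv\<close> survives in every term and
  completes \<delta> / (1 - lam) to (\<delta> + d) / (1 - lam).\<close>

lemma a_fun_eq: "a_fun lam d \<delta> \<rho> \<alpha> = semiconj lam d \<delta> \<rho> \<alpha> \<alpha>"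
proof -
  let ?x = "\<lambda>n. \<alpha> - real (Suc n) * \<rho>"
  have eq: "lam ^ Suc n * ((1 - lam) * real_of_int \<lfloor>?x n\<rfloor> + d * step \<alpha> (frac (?x n)))
      = (1 - lam - d) * (lam ^ Suc n * real_of_int \<lfloor>\<alpha> + real (Suc n) * - \<rho>\<rfloor>)
        + d * (lam ^ Suc n * real_of_int \<lfloor>\<alpha> - \<alpha> + real (Suc n) * - \<rho>\<rfloor>) + d * lam ^ Suc n" for n
  proof -
    have 1: "\<alpha> + real (Suc n) * - \<rho> = ?x n" "\<alpha> - \<alpha> + real (Suc n) * - \<rho> = ?x n - \<alpha>" by simp_all
    show ?thesis
      unfolding 1 floor_step_conv[OF \<alpha>] by (simp only: distrib_left mult_ac)
  qed
  have "(\<Sum>n. lam ^ Suc n * ((1 - lam) * real_of_int \<lfloor>?x n\<rfloor> + d * step \<alpha> (frac (?x n))))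
      = (1 - lam - d) * floor_series lam (- \<rho>) \<alpha> + d * floor_series lam (- \<rho>) (\<alpha> - \<alpha>)
        + d * (lam / (1 - lam))"
    unfolding eq
    by (rule sums_unique[symmetric]) (intro sums_add sums_mult floor_series_sums power_Suc_sums lam)
  then show ?thesis
    using lam unfolding a_fun_def semiconj_def
    by (simp add: add_divide_distrib)
qed

lemma delta_left_eq:
  "delta_left lam d \<rho> \<alpha> = 1 - lam - d + (1 - lam) / lam *
     ((1 - lam - d) * ceiling_series lam \<rho> 0 + d * ceiling_series lam \<rho> \<alpha>)"
proof (rule tendsto_unique)
  show "((\<lambda>r. delta_fun lam d r \<alpha>) \<longlongrightarrow> delta_left lam d \<rho> \<alpha>) (at_left \<rho>)"
    using lam d by (intro tendsto_delta_left) auto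
  show "((\<lambda>r. delta_fun lam d r \<alpha>) \<longlongrightarrow> 1 - lam - d + (1 - lam) / lam *
     ((1 - lam - d) * ceiling_series lam \<rho> 0 + d * ceiling_series lam \<rho> \<alpha>)) (at_left \<rho>)"
    unfolding delta_fun_eq by (intro tendsto_intros tendsto_floor_series_left lam)
qed simp

lemma a_right_eq: "a_right lam d \<delta> \<rho> \<alpha> = semiconj_left lam d \<delta> \<rho> \<alpha> \<alpha>"
proof (rule tendsto_unique)
  show "((\<lambda>r. a_fun lam d \<delta> r \<alpha>) \<longlongrightarrow> a_right lam d \<delta> \<rho> \<alpha>) (at_right \<rho>)"
    using lam d by (intro tendsto_a_right) auto
  \<comment> \<open>The frequency is -r, so a right limit in r is a left limit in the
    frequency.\<close>
  have *: "((\<lambda>r. floor_series lam (- r) \<beta>) \<longlongrightarrow> ceiling_series lam (- \<rho>) \<beta>) (at_right \<rho>)" for \<beta>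
    using tendsto_floor_series_left[OF lam, of \<beta> "- \<rho>"]
    by (simp add: filterlim_at_left_to_right)
  show "((\<lambda>r. a_fun lam d \<delta> r \<alpha>) \<longlongrightarrow> semiconj_left lam d \<delta> \<rho> \<alpha> \<alpha>) (at_right \<rho>)"
    unfolding a_fun_eq semiconj_def semiconj_left_def
    using lam by (intro tendsto_intros *) auto
qed simp

text \<open>Stated for arbitrary s and s' so as to serve floor and ceiling sums alike. The weights 1
  - lam - d and d add up to 1 - lam, so the two terms - lam / (1 - lam) together contribute
  -lam.\<close>

lemma semiconj_0_aux:
  "(\<delta> - (1 - lam - d + (1 - lam) / lam *
      ((1 - lam - d) * (- s - lam / (1 - lam)) + d * (- s' - lam / (1 - lam))))) / (1 - lam)
    = (\<delta> + d) / (1 - lam) + ((1 - lam - d) * s + d * s') / lam"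
proof -
  define k X where "k = 1 - lam" and "X = (k - d) * (- s - lam / k) + d * (- s' - lam / k)"
  have k: "k \<noteq> 0" "lam \<noteq> 0" using lam by (auto simp: k_def)
  have "X = - ((k - d) * s + d * s') - k * (lam / k)"
    unfolding X_def by (simp only: distrib_left distrib_right left_diff_distrib right_diff_distrib
        mult_minus_left mult_minus_right)
  then have X: "X / lam = - (((k - d) * s + d * s') / lam) - 1"
    using k by (simp add: diff_divide_distrib add_divide_distrib)
  have "(\<delta> - (k - d + k / lam * X)) / k = (\<delta> + d) / k - 1 - X / lam"
    using k by (simp add: diff_divide_distrib add_divide_distrib)
  then show ?thesis unfolding X unfolding X_def k_def by simp
qed

text \<open>Reflection exchanges floor and ceiling series. Hence the value at 0 involves the left
  limit of \<delta>(\<rho>,\<alpha>), while the left limit at 0 involves \<delta>(\<rho>,\<alpha>)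
  itself.\<close>

lemma semiconj_0: "semiconj lam d \<delta> \<rho> \<alpha> 0 = (\<delta> - delta_left lam d \<rho> \<alpha>) / (1 - lam)"
  unfolding semiconj_def delta_left_eq ceiling_series_eq[OF lam] semiconj_0_aux by simp

lemma semiconj_left_0: "semiconj_left lam d \<delta> \<rho> \<alpha> 0 = (\<delta> - delta_fun lam d \<rho> \<alpha>) / (1 - lam)"
proof -
  have "floor_series lam \<rho> \<beta> = - ceiling_series lam (- \<rho>) (- \<beta>) - lam / (1 - lam)" for \<beta>
    by (simp add: ceiling_series_eq[OF lam])
  then show ?thesis
    unfolding semiconj_left_def delta_fun_eq by (simp only: semiconj_0_aux) simp
qed

section \<open>Monotonicity, integer translation and functional equation of \<phi>\<close>

lemma semiconj_mono: "x \<le> y \<Longrightarrow> semiconj lam d \<delta> \<rho> \<alpha> x \<le> semiconj lam d \<delta> \<rho> \<alpha> y"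
  unfolding semiconj_def using lam d
  by (intro add_left_mono divide_right_mono add_mono mult_left_mono floor_series_mono) auto

lemma semiconj_left_mono:
  "x \<le> y \<Longrightarrow> semiconj_left lam d \<delta> \<rho> \<alpha> x \<le> semiconj_left lam d \<delta> \<rho> \<alpha> y"
  unfolding semiconj_left_def using lam d
  by (intro add_left_mono divide_right_mono add_mono mult_left_mono ceiling_series_mono) auto

lemma semiconj_le_semiconj_left:
  "x < y \<Longrightarrow> semiconj lam d \<delta> \<rho> \<alpha> x \<le> semiconj_left lam d \<delta> \<rho> \<alpha> y"
  unfolding semiconj_def semiconj_left_def using lam d
  by (intro add_left_mono divide_right_mono add_mono mult_left_mono
      floor_series_le_ceiling_series) auto

text \<open>The weights add up to 1 - lam, which cancels the denominator in m lam / (1 -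
  lam).\<close>

lemma weighted_add_int_aux:
  "((1 - lam - d) * (s + m * (lam / (1 - lam))) + d * (s' + m * (lam / (1 - lam)))) / lam
     = ((1 - lam - d) * s + d * s') / lam + m"
proof -
  have "(1 - lam - d) * (s + m * (lam / (1 - lam))) + d * (s' + m * (lam / (1 - lam)))
      = (1 - lam - d) * s + d * s' + m * ((1 - lam) * (lam / (1 - lam)))"
    by (simp only: distrib_left distrib_right left_diff_distrib right_diff_distrib mult_ac)
  then show ?thesis using lam by (simp add: add_divide_distrib)
qed

text \<open>The constant e = (\<delta> + d) / (1 - lam) satisfies e = lam e + \<delta> + d, and the
  inner factors \<open>lam\<close> cancel the division by \<open>lam\<close>.\<close>

lemma weighted_shift_aux:
  "(\<delta> + d) / (1 - lam) + ((1 - lam - d) * (lam * (m + s)) + d * (lam * (m' + s'))) / lam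
    = lam * ((\<delta> + d) / (1 - lam) + ((1 - lam - d) * s + d * s') / lam) + \<delta>
      + ((1 - lam - d) * m + d * m' + d)"
proof -
  define e where "e = (\<delta> + d) / (1 - lam)"
  have "e = lam * e + (1 - lam) * e" by (simp add: algebra_simps)
  also have "(1 - lam) * e = \<delta> + d" using lam by (simp add: e_def)
  finally have e: "e = lam * e + (\<delta> + d)" .
  have "((1 - lam - d) * (lam * (m + s)) + d * (lam * (m' + s'))) / lam
      = lam * ((1 - lam - d) * (m + s) + d * (m' + s')) / lam"
    by (simp only: distrib_left distrib_right mult_ac)
  also have "\<dots> = (1 - lam - d) * (m + s) + d * (m' + s')"
    using lam by simp
  finally have "((1 - lam - d) * (lam * (m + s)) + d * (lam * (m' + s'))) / lam = \<dots>" .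
  moreover have "lam * (e + ((1 - lam - d) * s + d * s') / lam)
      = lam * e + ((1 - lam - d) * s + d * s')"
    using lam unfolding distrib_left[of lam e] by simp
  ultimately show ?thesis
    unfolding e_def[symmetric] using e by (simp add: algebra_simps)
qed

lemma semiconj_add_int:
  "semiconj lam d \<delta> \<rho> \<alpha> (y + of_int m) = semiconj lam d \<delta> \<rho> \<alpha> y + of_int m"
proof -
  have "y + of_int m - \<alpha> = y - \<alpha> + of_int m" by simp
  then show ?thesis
    using lam unfolding semiconj_def
    by (simp only: floor_series_add_int[OF lam] weighted_add_int_aux add.assoc)
qed

lemma semiconj_left_add_int:
  "semiconj_left lam d \<delta> \<rho> \<alpha> (y + of_int m) = semiconj_left lam d \<delta> \<rho> \<alpha> y + of_int m"
proof -
  have "y + of_int m - \<alpha> = y - \<alpha> + of_int m" by simp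
  then show ?thesis
    using lam unfolding semiconj_left_def
    by (simp only: ceiling_series_add_int[OF lam] weighted_add_int_aux add.assoc)
qed

text \<open>The bracket has the shape of the one in \<open>lift_map_conv\<close>, with y and y -
  \<alpha> in place of x and x - a. Comparing orbits thus amounts to comparing these integer
  parts.\<close>

lemma semiconj_shift:
  "semiconj lam d \<delta> \<rho> \<alpha> (y + \<rho>) = lam * semiconj lam d \<delta> \<rho> \<alpha> y + \<delta>
     + ((1 - lam - d) * real_of_int \<lfloor>y\<rfloor> + d * real_of_int \<lfloor>y - \<alpha>\<rfloor> + d)"
proof -
  have "floor_series lam (- \<rho>) (x + \<rho>) = lam * (real_of_int \<lfloor>x\<rfloor> + floor_series lam (- \<rho>) x)" for x
    using floor_series_shift[OF lam, of "- \<rho>" x] by simp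
  moreover have "y + \<rho> - \<alpha> = y - \<alpha> + \<rho>" by simp
  ultimately show ?thesis
    unfolding semiconj_def by (simp only: weighted_shift_aux)
qed

lemma semiconj_left_shift:
  "semiconj_left lam d \<delta> \<rho> \<alpha> (y + \<rho>) = lam * semiconj_left lam d \<delta> \<rho> \<alpha> y + \<delta>
     + ((1 - lam - d) * (real_of_int \<lceil>y\<rceil> - 1) + d * (real_of_int \<lceil>y - \<alpha>\<rceil> - 1) + d)"
proof -
  have "ceiling_series lam (- \<rho>) (x + \<rho>) = lam * (real_of_int \<lceil>x\<rceil> - 1 + ceiling_series lam (- \<rho>) x)" for x
    using ceiling_series_shift[OF lam, of "- \<rho>" x] by simp
  moreover have "y + \<rho> - \<alpha> = y - \<alpha> + \<rho>" by simp
  ultimately show ?thesis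
    unfolding semiconj_left_def by (simp only: weighted_shift_aux)
qed

lemma lift_map_conv:
  assumes "0 \<le> a" "a \<le> 1"
  shows "lift_map lam d \<delta> a x = lam * x + \<delta>
    + ((1 - lam - d) * real_of_int \<lfloor>x\<rfloor> + d * real_of_int \<lfloor>x - a\<rfloor> + d)"
  using floor_step_conv[OF assms, of lam x d] by (simp add: lift_map_def)

section \<open>Jumps as weighted integer hits\<close>

lemma semiconj_jump:
  "semiconj lam d \<delta> \<rho> \<alpha> y - semiconj_left lam d \<delta> \<rho> \<alpha> y
     = ((1 - lam - d) * integer_hits lam (- \<rho>) y + d * integer_hits lam (- \<rho>) (y - \<alpha>)) / lam"
  unfolding semiconj_def semiconj_left_def integer_hits_eq[OF lam]
  by (simp add: right_diff_distrib diff_divide_distrib add_divide_distrib)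

lemma a_jump:
  "a_fun lam d \<delta> \<rho> \<alpha> - a_right lam d \<delta> \<rho> \<alpha>
     = ((1 - lam - d) * integer_hits lam \<rho> (- \<alpha>) + d * integer_hits lam \<rho> 0) / lam"
  using integer_hits_uminus[OF lam, of \<rho> "- \<alpha>"] integer_hits_uminus[OF lam, of \<rho> 0]
  by (simp add: a_fun_eq a_right_eq semiconj_jump)

lemma delta_jump:
  "delta_fun lam d \<rho> \<alpha> - delta_left lam d \<rho> \<alpha>
     = (1 - lam) / lam * ((1 - lam - d) * integer_hits lam \<rho> 0 + d * integer_hits lam \<rho> \<alpha>)"
proof -
  have "delta_fun lam d \<rho> \<alpha> - delta_left lam d \<rho> \<alpha> = (1 - lam) / lam *
      (((1 - lam - d) * floor_series lam \<rho> 0 + d * floor_series lam \<rho> \<alpha>)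
       - ((1 - lam - d) * ceiling_series lam \<rho> 0 + d * ceiling_series lam \<rho> \<alpha>))"
    unfolding delta_fun_eq delta_left_eq by (simp only: right_diff_distrib add_diff_cancel_left)
  also have "((1 - lam - d) * floor_series lam \<rho> 0 + d * floor_series lam \<rho> \<alpha>)
       - ((1 - lam - d) * ceiling_series lam \<rho> 0 + d * ceiling_series lam \<rho> \<alpha>)
      = (1 - lam - d) * integer_hits lam \<rho> 0 + d * integer_hits lam \<rho> \<alpha>"
    unfolding integer_hits_eq[OF lam] by (simp add: right_diff_distrib)
  finally show ?thesis .
qed

section \<open>Trapping of orbits and the rotation number\<close>

lemma semiconj_shift_le_lift_map:
  assumes a: "0 \<le> a" "a \<le> 1"
    and 0: "0 \<le> semiconj lam d \<delta> \<rho> \<alpha> 0" and \<alpha>': "a \<le> semiconj lam d \<delta> \<rho> \<alpha> \<alpha>"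
    and x: "semiconj lam d \<delta> \<rho> \<alpha> y \<le> x"
  shows "semiconj lam d \<delta> \<rho> \<alpha> (y + \<rho>) \<le> lift_map lam d \<delta> a x"
proof -
  \<comment> \<open>Monotonicity and integer translation give x \<ge> \<phi>(y) \<ge> \<phi>(0) +
    \<lfloor>y\<rfloor> \<ge> \<lfloor>y\<rfloor>. The same argument from the base point \<alpha>
    bounds the other floor.\<close>
  have "semiconj lam d \<delta> \<rho> \<alpha> (0 + of_int \<lfloor>y\<rfloor>) \<le> semiconj lam d \<delta> \<rho> \<alpha> y"
    by (rule semiconj_mono) linarith
  then have "real_of_int \<lfloor>y\<rfloor> \<le> x"
    using 0 x unfolding semiconj_add_int by linarith
  then have 1: "real_of_int \<lfloor>y\<rfloor> \<le> real_of_int \<lfloor>x\<rfloor>" by (simp add: le_floor_iff)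
  have "semiconj lam d \<delta> \<rho> \<alpha> (\<alpha> + of_int \<lfloor>y - \<alpha>\<rfloor>) \<le> semiconj lam d \<delta> \<rho> \<alpha> y"
    by (rule semiconj_mono) linarith
  then have "real_of_int \<lfloor>y - \<alpha>\<rfloor> \<le> x - a"
    using \<alpha>' x unfolding semiconj_add_int by linarith
  then have 2: "real_of_int \<lfloor>y - \<alpha>\<rfloor> \<le> real_of_int \<lfloor>x - a\<rfloor>" by (simp add: le_floor_iff)
  show ?thesis
    unfolding semiconj_shift lift_map_conv[OF a]
    using lam d x by (intro add_mono mult_left_mono order_refl 1 2) auto
qed

text \<open>
  The inequality has to be strict: at a boundary parameter \<open>semiconj_left\<close> may hit a jump of the
  right-continuous lift, and \<open>F (semiconj_left y)\<close> is then too large.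
\<close>

lemma lift_map_less_semiconj_left_shift:
  assumes a: "0 \<le> a" "a \<le> 1"
    and 0: "semiconj_left lam d \<delta> \<rho> \<alpha> 0 \<le> 0" and \<alpha>': "semiconj_left lam d \<delta> \<rho> \<alpha> \<alpha> \<le> a"
    and x: "x < semiconj_left lam d \<delta> \<rho> \<alpha> y"
  shows "lift_map lam d \<delta> a x < semiconj_left lam d \<delta> \<rho> \<alpha> (y + \<rho>)"
proof -
  have "semiconj_left lam d \<delta> \<rho> \<alpha> y \<le> semiconj_left lam d \<delta> \<rho> \<alpha> (0 + of_int \<lceil>y\<rceil>)"
    by (rule semiconj_left_mono) linarith
  then have "x < real_of_int \<lceil>y\<rceil>"
    using 0 x unfolding semiconj_left_add_int by linarith
  then have "\<lfloor>x\<rfloor> \<le> \<lceil>y\<rceil> - 1" by linarith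
  then have 1: "real_of_int \<lfloor>x\<rfloor> \<le> real_of_int \<lceil>y\<rceil> - 1" by linarith
  have "semiconj_left lam d \<delta> \<rho> \<alpha> y \<le> semiconj_left lam d \<delta> \<rho> \<alpha> (\<alpha> + of_int \<lceil>y - \<alpha>\<rceil>)"
    by (rule semiconj_left_mono) linarith
  then have "x - a < real_of_int \<lceil>y - \<alpha>\<rceil>"
    using \<alpha>' x unfolding semiconj_left_add_int by linarith
  then have "\<lfloor>x - a\<rfloor> \<le> \<lceil>y - \<alpha>\<rceil> - 1" by linarith
  then have 2: "real_of_int \<lfloor>x - a\<rfloor> \<le> real_of_int \<lceil>y - \<alpha>\<rceil> - 1" by linarith
  show ?thesis
    unfolding semiconj_left_shift lift_map_conv[OF a]
    using lam d x
    by (intro add_less_le_mono add_strict_right_mono mult_strict_left_mono add_mono mult_left_mono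
        order_refl 1 2) auto
qed

text \<open>The trapping inequalities iterate. Since \<phi>(w) \<ge> w - 1 and \<psi>(w) \<le> w +
  1, every orbit stays within bounded distance of n\<rho>.\<close>

lemma has_rotation_number_lift_map:
  assumes \<rho>: "0 \<le> \<rho>" "\<rho> < 1" and a: "0 \<le> a" "a \<le> 1"
    and \<delta>: "delta_left lam d \<rho> \<alpha> \<le> \<delta>" "\<delta> \<le> delta_fun lam d \<rho> \<alpha>"
    and a': "a_right lam d \<delta> \<rho> \<alpha> \<le> a" "a \<le> a_fun lam d \<delta> \<rho> \<alpha>"
  shows "has_rotation_number (lift_map lam d \<delta> a) \<rho>"
proof -
  let ?F = "lift_map lam d \<delta> a" and ?\<phi> = "semiconj lam d \<delta> \<rho> \<alpha>"
    and ?\<psi> = "semiconj_left lam d \<delta> \<rho> \<alpha>"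
  have \<phi>: "0 \<le> ?\<phi> 0" "a \<le> ?\<phi> \<alpha>" and \<psi>: "?\<psi> 0 \<le> 0" "?\<psi> \<alpha> \<le> a"
    using \<delta> a' lam
    by (simp_all add: semiconj_0 semiconj_left_0 a_fun_eq a_right_eq divide_le_0_iff)
  have "(\<lambda>n. (?F ^^ n) x / real n) \<longlonglongrightarrow> \<rho>" for x
  proof -
    \<comment> \<open>Integer translations move \<phi> and \<psi> by the same integer, so they reach
      starting values below and above x. The + 1 in z makes the upper inequality strict, as its
      induction requires.\<close>
    define y where "y = real_of_int \<lfloor>x - ?\<phi> 0\<rfloor>"
    define z where "z = real_of_int (\<lfloor>x - ?\<psi> 0\<rfloor> + 1)"
    have "?\<phi> (0 + y) \<le> x" unfolding y_def semiconj_add_int by linarith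
    then have lower: "?\<phi> (y + real n * \<rho>) \<le> (?F ^^ n) x" for n
    proof (induction n)
      case (Suc n)
      have *: "y + real (Suc n) * \<rho> = (y + real n * \<rho>) + \<rho>" by (simp add: algebra_simps)
      show ?case
        using semiconj_shift_le_lift_map[OF a \<phi> Suc.IH[OF Suc.prems]] unfolding * by simp
    qed simp
    have "x < ?\<psi> (0 + z)" unfolding z_def semiconj_left_add_int by linarith
    then have upper: "(?F ^^ n) x < ?\<psi> (z + real n * \<rho>)" for n
    proof (induction n)
      case (Suc n)
      have *: "z + real (Suc n) * \<rho> = (z + real n * \<rho>) + \<rho>" by (simp add: algebra_simps)
      show ?case
        using lift_map_less_semiconj_left_shift[OF a \<psi> Suc.IH[OF Suc.prems]] unfolding * by simp
    qed simp
    have "w - 1 \<le> ?\<phi> w" for w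
    proof -
      have "?\<phi> (0 + of_int \<lfloor>w\<rfloor>) \<le> ?\<phi> w" by (rule semiconj_mono) linarith
      then show ?thesis using \<phi>(1) unfolding semiconj_add_int by linarith
    qed
    from order_trans[OF this lower] have lo: "y - 1 + real n * \<rho> \<le> (?F ^^ n) x" for n
      by (simp add: algebra_simps)
    have "?\<psi> w \<le> w + 1" for w
    proof -
      have "?\<psi> w \<le> ?\<psi> (0 + of_int \<lceil>w\<rceil>)" by (rule semiconj_left_mono) linarith
      then show ?thesis using \<psi>(1) unfolding semiconj_left_add_int by linarith
    qed
    from order_trans[OF less_imp_le[OF upper] this]
    have up: "(?F ^^ n) x \<le> z + 1 + real n * \<rho>" for n
      by (simp add: algebra_simps)
    have lim: "(\<lambda>n. (c + real n * \<rho>) / real n) \<longlonglongrightarrow> \<rho>" for c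
    proof (rule Lim_transform_eventually)
      show "(\<lambda>n. c / real n + \<rho>) \<longlonglongrightarrow> \<rho>"
        using tendsto_add[OF lim_const_over_n[of c] tendsto_const[of \<rho>]] by simp
      \<comment> \<open>For n = 0 division by zero makes the right side 0, so the identity is used
        only for n > 0.\<close>
      show "\<forall>\<^sub>F n in sequentially. c / real n + \<rho> = (c + real n * \<rho>) / real n"
        using eventually_gt_at_top[of 0] by eventually_elim (simp add: add_divide_distrib)
    qed
    show ?thesis
      by (rule tendsto_sandwich[OF _ _ lim[of "y - 1"] lim[of "z + 1"]])
         (intro always_eventually allI divide_right_mono lo up; simp)+
  qed
  moreover have "\<rho> = frac \<rho>" using \<rho> by (simp add: frac_eq)
  ultimately show ?thesis unfolding has_rotation_number_def by blast
qed

section \<open>Location of the parameter intervals\<close>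

lemma delta_left_gt:
  assumes "0 < \<rho>"
  shows "1 - lam - d < delta_left lam d \<rho> \<alpha>"
proof -
  have "0 < ceiling_series lam \<rho> 0" using ceiling_series_pos[OF lam assms] .
  moreover have "ceiling_series lam \<rho> 0 \<le> ceiling_series lam \<rho> \<alpha>"
    using ceiling_series_mono[OF lam \<alpha>(1)] .
  ultimately show ?thesis
    using lam d unfolding delta_left_eq by (simp add: add_pos_pos)
qed

text \<open>Replacing \<alpha> by 1 adds at most L = lam / (1 - lam) to the series at 0, which is
  below L^2. The resulting bound is exactly lam + d, the complement of 1 - lam - d.\<close>

lemma delta_fun_less_1:
  assumes "\<rho> < 1"
  shows "delta_fun lam d \<rho> \<alpha> < 1"
proof -
  define L where "L = lam / (1 - lam)"
  have L: "(1 - lam) / lam * L = 1" "(1 - lam) * L = lam" using lam by (simp_all add: L_def)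
  let ?s = "floor_series lam \<rho> 0"
  have s: "?s < L * L"
    using floor_series_less[OF lam assms] by (simp add: power2_eq_square L_def)
  have "floor_series lam \<rho> \<alpha> \<le> floor_series lam \<rho> (0 + of_int 1)"
    using \<alpha> by (intro floor_series_mono[OF lam]) simp
  also have "\<dots> = ?s + L"
    unfolding floor_series_add_int[OF lam] by (simp add: L_def)
  finally have "d * floor_series lam \<rho> \<alpha> \<le> d * (?s + L)"
    using d by (intro mult_left_mono) auto
  then have "(1 - lam - d) * ?s + d * floor_series lam \<rho> \<alpha> \<le> (1 - lam) * ?s + d * L"
    by (simp add: algebra_simps)
  also have "\<dots> < (1 - lam) * (L * L) + d * L"
    using lam s by simp
  also have "(1 - lam) * (L * L) = lam * L"
    unfolding mult.assoc[symmetric] L(2) ..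
  also have "lam * L + d * L = (lam + d) * L"
    by (simp only: distrib_right)
  finally have "(1 - lam) / lam * ((1 - lam - d) * ?s + d * floor_series lam \<rho> \<alpha>)
      < (1 - lam) / lam * ((lam + d) * L)"
    using lam by (intro mult_strict_left_mono) auto
  also have "\<dots> = (lam + d) * ((1 - lam) / lam * L)" by (simp only: mult_ac)
  finally show ?thesis unfolding delta_fun_eq L(1) by simp
qed

lemma integer_hits_irrational_0:
  assumes "\<rho> \<notin> \<rat>"
  shows "integer_hits lam \<rho> 0 = 0"
proof -
  have "0 + real n * \<rho> \<notin> \<int>" if "n > 0" for n
  proof
    assume "0 + real n * \<rho> \<in> \<int>"
    then have "real n * \<rho> / real n \<in> \<rat>" by (intro Rats_divide) (auto intro: subsetD[OF Ints_subset_Rats])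
    with that assms show False by simp
  qed
  then show ?thesis by (simp add: integer_hits_eq_0_iff[OF lam])
qed

lemma a_right_le_a_fun: "a_right lam d \<delta> \<rho> \<alpha> \<le> a_fun lam d \<delta> \<rho> \<alpha>"
proof -
  have "0 \<le> a_fun lam d \<delta> \<rho> \<alpha> - a_right lam d \<delta> \<rho> \<alpha>"
    unfolding a_jump using lam d integer_hits_nonneg[OF lam] by simp
  then show ?thesis by simp
qed

lemma a_fun_nonneg:
  assumes "delta_left lam d \<rho> \<alpha> \<le> \<delta>"
  shows "0 \<le> a_fun lam d \<delta> \<rho> \<alpha>"
proof -
  have "0 \<le> semiconj lam d \<delta> \<rho> \<alpha> 0" using assms lam by (simp add: semiconj_0)
  also have "\<dots> \<le> a_fun lam d \<delta> \<rho> \<alpha>" unfolding a_fun_eq by (rule semiconj_mono) (rule \<alpha>)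
  finally show ?thesis .
qed

text \<open>A left limit dominates only values at strictly smaller arguments, hence 0 < \<alpha>;
  dually, \<open>a_fun_le_1\<close> assumes \<alpha> < 1.\<close>

lemma a_right_nonneg:
  assumes "delta_left lam d \<rho> \<alpha> \<le> \<delta>" "0 < \<alpha>"
  shows "0 \<le> a_right lam d \<delta> \<rho> \<alpha>"
proof -
  have "0 \<le> semiconj lam d \<delta> \<rho> \<alpha> 0" using assms lam by (simp add: semiconj_0)
  also have "\<dots> \<le> a_right lam d \<delta> \<rho> \<alpha>"
    unfolding a_right_eq by (rule semiconj_le_semiconj_left) (rule assms)
  finally show ?thesis .
qed

lemma semiconj_left_1_le:
  assumes "\<delta> \<le> delta_fun lam d \<rho> \<alpha>"
  shows "semiconj_left lam d \<delta> \<rho> \<alpha> 1 \<le> 1"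
proof -
  have "semiconj_left lam d \<delta> \<rho> \<alpha> 0 \<le> 0"
    using assms lam by (simp add: semiconj_left_0 divide_le_0_iff)
  then show ?thesis using semiconj_left_add_int[of \<delta> \<rho> 0 1] by simp
qed

lemma a_right_le_1:
  assumes "\<delta> \<le> delta_fun lam d \<rho> \<alpha>"
  shows "a_right lam d \<delta> \<rho> \<alpha> \<le> 1"
  unfolding a_right_eq
  using semiconj_left_mono[OF \<alpha>(2)] semiconj_left_1_le[OF assms] by (rule order_trans)

lemma a_fun_le_1:
  assumes "\<delta> \<le> delta_fun lam d \<rho> \<alpha>" "\<alpha> < 1"
  shows "a_fun lam d \<delta> \<rho> \<alpha> \<le> 1"
  unfolding a_fun_eq
  using semiconj_le_semiconj_left[OF assms(2)] semiconj_left_1_le[OF assms(1)] by (rule order_trans)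

text \<open>For \<alpha> in {0,1} the hits at -\<alpha> are those at 0, and there are none. The
  interval for a is then a single point, which settles the endpoint cases of the inclusion.\<close>

lemma a_fun_eq_a_right_irrational:
  assumes "\<rho> \<notin> \<rat>" "\<alpha> \<in> {0, 1}"
  shows "a_fun lam d \<delta> \<rho> \<alpha> = a_right lam d \<delta> \<rho> \<alpha>"
proof -
  have "integer_hits lam \<rho> (- \<alpha>) = integer_hits lam \<rho> 0"
    using assms(2) integer_hits_add_int[OF lam, of \<rho> 0 "- 1"] by auto
  then show ?thesis
    using a_jump[of \<delta> \<rho>] integer_hits_irrational_0[OF assms(1)] by simp
qed

lemma a_interval_inter_unit:
  assumes "delta_left lam d \<rho> \<alpha> \<le> \<delta>" "\<delta> \<le> delta_fun lam d \<rho> \<alpha>"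
  shows "{a_right lam d \<delta> \<rho> \<alpha>..a_fun lam d \<delta> \<rho> \<alpha>} \<inter> {0..1} \<noteq> {}"
proof -
  \<comment> \<open>This witness needs only \<open>0 \<le> a_fun\<close> and
    \<open>a_right \<le> 1\<close>, which hold for all \<alpha> in [0,1].\<close>
  have "max 0 (a_right lam d \<delta> \<rho> \<alpha>) \<in> {a_right lam d \<delta> \<rho> \<alpha>..a_fun lam d \<delta> \<rho> \<alpha>} \<inter> {0..1}"
    using a_fun_nonneg[OF assms(1)] a_right_le_1[OF assms(2)] a_right_le_a_fun by simp
  then show ?thesis by blast
qed

lemma a_interval_subset_unit:
  assumes "delta_left lam d \<rho> \<alpha> \<le> \<delta>" "\<delta> \<le> delta_fun lam d \<rho> \<alpha>"
    and "\<alpha> \<in> {0<..<1} \<or> \<rho> \<notin> \<rat>"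
  shows "{a_right lam d \<delta> \<rho> \<alpha>..a_fun lam d \<delta> \<rho> \<alpha>} \<subseteq> {0..1}"
proof (cases "\<alpha> \<in> {0<..<1}")
  case True
  then show ?thesis
    using a_right_nonneg[OF assms(1)] a_fun_le_1[OF assms(2)] by auto
next
  case False
  then have "\<alpha> \<in> {0, 1}" "\<rho> \<notin> \<rat>" using \<alpha> assms(3) by auto
  from a_fun_eq_a_right_irrational[OF this(2,1)] show ?thesis
    using a_fun_nonneg[OF assms(1)] a_right_le_1[OF assms(2)] by simp
qed

section \<open>Jumps for irrational and for rational \<rho>\<close>

lemma irrational_jumps:
  assumes "\<rho> \<notin> \<rat>"
  shows "if \<forall>k::int. k \<noteq> 0 \<longrightarrow> real_of_int k * \<rho> \<notin> (\<lambda>z. z + \<alpha>) ` \<int>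
    then delta_left lam d \<rho> \<alpha> = delta_fun lam d \<rho> \<alpha> \<and> a_fun lam d \<delta> \<rho> \<alpha> = a_right lam d \<delta> \<rho> \<alpha>
    else (delta_left lam d \<rho> \<alpha> < delta_fun lam d \<rho> \<alpha>) \<noteq> (a_right lam d \<delta> \<rho> \<alpha> < a_fun lam d \<delta> \<rho> \<alpha>)"
proof -
  let ?P = "integer_hits lam \<rho> \<alpha>" and ?N = "integer_hits lam \<rho> (- \<alpha>)"
  have jumps: "delta_fun lam d \<rho> \<alpha> - delta_left lam d \<rho> \<alpha> = (1 - lam) / lam * (d * ?P)"
    "a_fun lam d \<delta> \<rho> \<alpha> - a_right lam d \<delta> \<rho> \<alpha> = (1 - lam - d) * ?N / lam"
    using delta_jump[of \<rho>] a_jump[of \<delta> \<rho>] integer_hits_irrational_0[OF assms] by simp_all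
  have pos: "0 < (1 - lam) / lam * (d * P) \<longleftrightarrow> 0 < P" "0 < (1 - lam - d) * P / lam \<longleftrightarrow> 0 < P" for P
    using lam d by (simp_all add: zero_less_mult_iff zero_less_divide_iff)
  have lt: "delta_left lam d \<rho> \<alpha> < delta_fun lam d \<rho> \<alpha> \<longleftrightarrow> ?P \<noteq> 0"
    "a_right lam d \<delta> \<rho> \<alpha> < a_fun lam d \<delta> \<rho> \<alpha> \<longleftrightarrow> ?N \<noteq> 0"
    using pos[of ?P] pos[of ?N] integer_hits_nonneg[OF lam, of \<rho> \<alpha>]
      integer_hits_nonneg[OF lam, of \<rho> "- \<alpha>"]
    unfolding jumps[symmetric] by auto
  note hits_0 = integer_hits_eq_0_iff[OF lam]
  note no_hit = iffD1[OF hits_0, rule_format]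
  \<comment> \<open>Adding a hit \<alpha> + m\<rho> to a hit -\<alpha> + n\<rho> would make (m +
    n)\<rho> an integer. So the alternative is exclusive, which is why it is written as \<noteq>
    between truth values.\<close>
  have not_both: "\<not> (?P \<noteq> 0 \<and> ?N \<noteq> 0)"
  proof
    assume "?P \<noteq> 0 \<and> ?N \<noteq> 0"
    then obtain m n where m: "m > 0" "\<alpha> + real m * \<rho> \<in> \<int>" and n: "- \<alpha> + real n * \<rho> \<in> \<int>"
      unfolding hits_0 not_all not_imp not_not by (elim exE conjE)
    have "\<alpha> + real m * \<rho> + (- \<alpha> + real n * \<rho>) = 0 + real (m + n) * \<rho>"
      by (simp add: distrib_right)
    with Ints_add[OF m(2) n] have "0 + real (m + n) * \<rho> \<in> \<int>" by (simp only:)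
    moreover have "m + n > 0" using m(1) by simp
    ultimately show False
      using no_hit[OF integer_hits_irrational_0[OF assms], of "m + n"] by simp
  qed
  \<comment> \<open>Negative k = -n correspond to hits \<alpha> + n\<rho>, positive k = n to hits
    -\<alpha> + n\<rho>.\<close>
  have "(\<forall>k::int. k \<noteq> 0 \<longrightarrow> real_of_int k * \<rho> \<notin> (\<lambda>z. z + \<alpha>) ` \<int>) \<longleftrightarrow> ?P = 0 \<and> ?N = 0"
    unfolding mem_image_add_Ints_iff
  proof (intro iffI conjI)
    assume *: "\<forall>k::int. k \<noteq> 0 \<longrightarrow> real_of_int k * \<rho> - \<alpha> \<notin> \<int>"
    show "?P = 0" unfolding hits_0
    proof (intro allI impI)
      fix n :: nat assume "n > 0"
      then have "real_of_int (- int n) * \<rho> - \<alpha> \<notin> \<int>" using *[rule_format, of "- int n"] by simp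
      moreover have "real_of_int (- int n) * \<rho> - \<alpha> = - (\<alpha> + real n * \<rho>)" by simp
      ultimately show "\<alpha> + real n * \<rho> \<notin> \<int>" by (simp only: minus_in_Ints_iff not_False_eq_True)
    qed
    show "?N = 0" unfolding hits_0
    proof (intro allI impI)
      fix n :: nat assume "n > 0"
      then have "real_of_int (int n) * \<rho> - \<alpha> \<notin> \<int>" using *[rule_format, of "int n"] by simp
      then show "- \<alpha> + real n * \<rho> \<notin> \<int>" by simp
    qed
  next
    assume 0: "?P = 0 \<and> ?N = 0"
    show "\<forall>k::int. k \<noteq> 0 \<longrightarrow> real_of_int k * \<rho> - \<alpha> \<notin> \<int>"
    proof (intro allI impI)
      fix k :: int assume "k \<noteq> 0"
      then consider n where "n > 0" "k = int n" | n where "n > 0" "k = - int n"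
        by (cases k rule: int_cases2) auto
      then show "real_of_int k * \<rho> - \<alpha> \<notin> \<int>"
      proof cases
        case 1
        have "- \<alpha> + real n * \<rho> \<notin> \<int>" by (rule no_hit) (use 0 1 in auto)
        then show ?thesis using 1 by simp
      next
        case 2
        have "\<alpha> + real n * \<rho> \<notin> \<int>" by (rule no_hit) (use 0 2 in auto)
        moreover have "real_of_int k * \<rho> - \<alpha> = - (\<alpha> + real n * \<rho>)" using 2 by simp
        ultimately show ?thesis by (simp only: minus_in_Ints_iff not_False_eq_True)
      qed
    qed
  qed
  note no_hit_iff = this
  have "delta_left lam d \<rho> \<alpha> = delta_fun lam d \<rho> \<alpha>" if "?P = 0"
    using jumps(1) that by simp
  moreover have "a_fun lam d \<delta> \<rho> \<alpha> = a_right lam d \<delta> \<rho> \<alpha>" if "?N = 0"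
    using jumps(2) that by simp
  ultimately show ?thesis
    using not_both unfolding no_hit_iff lt by auto
qed

text \<open>In both jump formulas the hits at 0 contribute exactly c = lam^q / (1 - lam^q), while
  those at \<alpha> or -\<alpha> are bounded below with equality iff nonresonant. The weights are
  positive, so equality carries over; the exponent q - 1 comes from the division by
  \<open>lam\<close>.\<close>

lemma rational_jumps:
  fixes p q :: nat
  assumes pq: "0 < p" "p < q" "coprime p q" and \<rho>: "\<rho> = real p / real q"
  defines "bound_delta \<equiv> lam ^ (q - 1) / (1 - lam ^ q) * (1 - lam) *
      (1 - lam - d + d * indicator {0, 1} \<alpha>)"
    and "bound_a \<equiv> lam ^ (q - 1) / (1 - lam ^ q) * ((1 - lam - d) * indicator {0, 1} \<alpha> + d)"
    and "nonresonant \<equiv> \<forall>r\<in>{1..q - 1}. real (r * p) / real q \<notin> (\<lambda>z. z + \<alpha>) ` \<int>"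
  shows "bound_delta \<le> delta_fun lam d \<rho> \<alpha> - delta_left lam d \<rho> \<alpha>"
    and "bound_a \<le> a_fun lam d \<delta> \<rho> \<alpha> - a_right lam d \<delta> \<rho> \<alpha>"
    and "delta_fun lam d \<rho> \<alpha> - delta_left lam d \<rho> \<alpha> = bound_delta \<longleftrightarrow> nonresonant"
    and "a_fun lam d \<delta> \<rho> \<alpha> - a_right lam d \<delta> \<rho> \<alpha> = bound_a \<longleftrightarrow> nonresonant"
proof -
  define c where "c = lam ^ q / (1 - lam ^ q)"
  let ?i = "indicator {0, 1} \<alpha> :: real"
  have "lam ^ q = lam * lam ^ (q - 1)" using pq by (cases q) auto
  then have c: "lam ^ (q - 1) / (1 - lam ^ q) = c / lam" using lam by (simp add: c_def)
  have J0: "integer_hits lam \<rho> 0 = c"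
    unfolding c_def \<rho> using pq by (intro integer_hits_rational[OF lam]) auto
  have nonres: "nonresonant \<longleftrightarrow> (\<forall>r\<in>{1..q - 1}. real (r * p) / real q - \<alpha> \<notin> \<int>)"
    unfolding nonresonant_def mem_image_add_Ints_iff ..
  have bd: "bound_delta = (1 - lam) / lam * ((1 - lam - d) * c + d * (?i * c))"
    unfolding bound_delta_def c by (simp only: distrib_left distrib_right times_divide_eq_left
        times_divide_eq_right mult_ac add_divide_distrib)
  have ba: "bound_a = ((1 - lam - d) * (?i * c) + d * c) / lam"
    unfolding bound_a_def c by (simp only: distrib_left distrib_right times_divide_eq_left
        times_divide_eq_right mult_ac add_divide_distrib)
  have hits: "?i * c \<le> integer_hits lam \<rho> \<beta>"
    "integer_hits lam \<rho> \<beta> = ?i * c \<longleftrightarrow> nonresonant" if "\<beta> = \<alpha> \<or> \<beta> = - \<alpha>" for \<beta>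
    unfolding c_def \<rho> nonres by (fact integer_hits_rational_ge[OF lam pq \<alpha> that])+
  show "bound_delta \<le> delta_fun lam d \<rho> \<alpha> - delta_left lam d \<rho> \<alpha>"
    unfolding bd delta_jump J0 using lam d hits(1)[of \<alpha>] by (intro mult_left_mono add_left_mono) auto
  show "bound_a \<le> a_fun lam d \<delta> \<rho> \<alpha> - a_right lam d \<delta> \<rho> \<alpha>"
    unfolding ba a_jump J0 using lam d hits(1)[of "- \<alpha>"]
    by (intro divide_right_mono add_right_mono mult_left_mono) auto
  have "delta_fun lam d \<rho> \<alpha> - delta_left lam d \<rho> \<alpha> = bound_delta
      \<longleftrightarrow> integer_hits lam \<rho> \<alpha> = ?i * c"
    unfolding bd delta_jump J0 using lam d by simp
  then show "delta_fun lam d \<rho> \<alpha> - delta_left lam d \<rho> \<alpha> = bound_delta \<longleftrightarrow> nonresonant"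
    using hits(2)[of \<alpha>] by simp
  have "a_fun lam d \<delta> \<rho> \<alpha> - a_right lam d \<delta> \<rho> \<alpha> = bound_a
      \<longleftrightarrow> integer_hits lam \<rho> (- \<alpha>) = ?i * c"
    unfolding ba a_jump J0 using lam d by simp
  then show "a_fun lam d \<delta> \<rho> \<alpha> - a_right lam d \<delta> \<rho> \<alpha> = bound_a \<longleftrightarrow> nonresonant"
    using hits(2)[of "- \<alpha>"] by simp
qed

end

theorem theorem2p3:
  fixes lam d \<rho> \<alpha> :: real
  assumes "0 < lam" "lam < 1" "0 < d" "d < 1 - lam"
    and "0 < \<rho>" "\<rho> < 1" "0 \<le> \<alpha>" "\<alpha> \<le> 1"
  shows
    "(\<forall>\<delta>\<in>{1 - lam - d<..<1}. \<forall>a\<in>{0..1}.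
        \<delta> \<in> {delta_left lam d \<rho> \<alpha>..delta_fun lam d \<rho> \<alpha>} \<and>
        a \<in> {a_right lam d \<delta> \<rho> \<alpha>..a_fun lam d \<delta> \<rho> \<alpha>} \<longrightarrow>
        has_rotation_number (lift_map lam d \<delta> a) \<rho>)
     \<and>
     ({delta_left lam d \<rho> \<alpha>..delta_fun lam d \<rho> \<alpha>} \<subseteq> {1 - lam - d<..<1} \<and>
      (\<forall>\<delta>\<in>{delta_left lam d \<rho> \<alpha>..delta_fun lam d \<rho> \<alpha>}.
         {a_right lam d \<delta> \<rho> \<alpha>..a_fun lam d \<delta> \<rho> \<alpha>} \<inter> {0..1} \<noteq> {} \<and>
         (\<alpha> \<in> {0<..<1} \<or> \<rho> \<notin> \<rat> \<longrightarrow>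
            {a_right lam d \<delta> \<rho> \<alpha>..a_fun lam d \<delta> \<rho> \<alpha>} \<subseteq> {0..1})))
     \<and>
     (\<rho> \<notin> \<rat> \<longrightarrow>
        (if \<forall>k::int. k \<noteq> 0 \<longrightarrow> real_of_int k * \<rho> \<notin> (\<lambda>z. z + \<alpha>) ` \<int>
         then delta_left lam d \<rho> \<alpha> = delta_fun lam d \<rho> \<alpha> \<and>
              (\<forall>\<delta>\<in>{0..1}. a_fun lam d \<delta> \<rho> \<alpha> = a_right lam d \<delta> \<rho> \<alpha>)
         else \<forall>\<delta>\<in>{0..1}.
              (delta_left lam d \<rho> \<alpha> < delta_fun lam d \<rho> \<alpha>) \<noteq>
              (a_right lam d \<delta> \<rho> \<alpha> < a_fun lam d \<delta> \<rho> \<alpha>)))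
     \<and>
     (\<forall>p q :: nat. 0 < p \<and> p < q \<and> coprime p q \<and> \<rho> = real p / real q \<longrightarrow>
        (let jump_delta = delta_fun lam d \<rho> \<alpha> - delta_left lam d \<rho> \<alpha>;
             jump_a = (\<lambda>\<delta>. a_fun lam d \<delta> \<rho> \<alpha> - a_right lam d \<delta> \<rho> \<alpha>);
             bound_delta = lam ^ (q - 1) / (1 - lam ^ q) * (1 - lam) *
                             (1 - lam - d + d * indicator {0, 1} \<alpha>);
             bound_a = lam ^ (q - 1) / (1 - lam ^ q) *
                         ((1 - lam - d) * indicator {0, 1} \<alpha> + d);
             nonresonant = (\<forall>r\<in>{1..q - 1}. real (r * p) / real q \<notin> (\<lambda>z. z + \<alpha>) ` \<int>)
         in jump_delta \<ge> bound_delta \<and>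
            (\<forall>\<delta>\<in>{0..1}. jump_a \<delta> \<ge> bound_a) \<and>
            (jump_delta = bound_delta \<longleftrightarrow> nonresonant) \<and>
            (\<forall>\<delta>\<in>{0..1}. jump_a \<delta> = bound_a \<longleftrightarrow> nonresonant)))"
proof (intro conjI)
  let ?dl = "delta_left lam d \<rho> \<alpha>" and ?df = "delta_fun lam d \<rho> \<alpha>"
  note asms = assms(1-4,7,8)
  show "\<forall>\<delta>\<in>{1 - lam - d<..<1}. \<forall>a\<in>{0..1}.
      \<delta> \<in> {?dl..?df} \<and> a \<in> {a_right lam d \<delta> \<rho> \<alpha>..a_fun lam d \<delta> \<rho> \<alpha>} \<longrightarrow>
      has_rotation_number (lift_map lam d \<delta> a) \<rho>"
    using has_rotation_number_lift_map[OF asms] assms(5,6) by auto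
  show "{?dl..?df} \<subseteq> {1 - lam - d<..<1}"
    using delta_left_gt[OF asms assms(5)] delta_fun_less_1[OF asms assms(6)] by auto
  show "\<forall>\<delta>\<in>{?dl..?df}.
      {a_right lam d \<delta> \<rho> \<alpha>..a_fun lam d \<delta> \<rho> \<alpha>} \<inter> {0..1} \<noteq> {} \<and>
      (\<alpha> \<in> {0<..<1} \<or> \<rho> \<notin> \<rat> \<longrightarrow> {a_right lam d \<delta> \<rho> \<alpha>..a_fun lam d \<delta> \<rho> \<alpha>} \<subseteq> {0..1})"
  proof (intro ballI conjI impI)
    fix \<delta> assume "\<delta> \<in> {?dl..?df}"
    then have \<delta>: "?dl \<le> \<delta>" "\<delta> \<le> ?df" by simp_all
    show "{a_right lam d \<delta> \<rho> \<alpha>..a_fun lam d \<delta> \<rho> \<alpha>} \<inter> {0..1} \<noteq> {}"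
      by (rule a_interval_inter_unit[OF asms \<delta>])
    show "{a_right lam d \<delta> \<rho> \<alpha>..a_fun lam d \<delta> \<rho> \<alpha>} \<subseteq> {0..1}" if "\<alpha> \<in> {0<..<1} \<or> \<rho> \<notin> \<rat>"
      by (rule a_interval_subset_unit[OF asms \<delta> that])
  qed
  let ?C = "\<forall>k::int. k \<noteq> 0 \<longrightarrow> real_of_int k * \<rho> \<notin> (\<lambda>z. z + \<alpha>) ` \<int>"
  show "\<rho> \<notin> \<rat> \<longrightarrow>
      (if ?C then ?dl = ?df \<and> (\<forall>\<delta>\<in>{0..1}. a_fun lam d \<delta> \<rho> \<alpha> = a_right lam d \<delta> \<rho> \<alpha>)
       else \<forall>\<delta>\<in>{0..1}. (?dl < ?df) \<noteq> (a_right lam d \<delta> \<rho> \<alpha> < a_fun lam d \<delta> \<rho> \<alpha>))"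
  proof
    assume "\<rho> \<notin> \<rat>"
    note jumps = irrational_jumps[OF asms this]
    show "if ?C then ?dl = ?df \<and> (\<forall>\<delta>\<in>{0..1}. a_fun lam d \<delta> \<rho> \<alpha> = a_right lam d \<delta> \<rho> \<alpha>)
       else \<forall>\<delta>\<in>{0..1}. (?dl < ?df) \<noteq> (a_right lam d \<delta> \<rho> \<alpha> < a_fun lam d \<delta> \<rho> \<alpha>)"
    \<comment> \<open>\<open>irrational_jumps\<close> speaks of a single \<delta>. As
      \<open>?C\<close> does not depend on \<delta>, deciding it first lets the quantifier enter the
      branches.\<close>
    proof (cases ?C)
      case True
      from jumps show ?thesis unfolding if_P[OF True] by simp
    next
      case False
      from jumps show ?thesis unfolding if_not_P[OF False] by blast
    qed
  qed
next
  note asms = assms(1-4,7,8)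
  show "\<forall>p q :: nat. 0 < p \<and> p < q \<and> coprime p q \<and> \<rho> = real p / real q \<longrightarrow>
        (let jump_delta = delta_fun lam d \<rho> \<alpha> - delta_left lam d \<rho> \<alpha>;
             jump_a = (\<lambda>\<delta>. a_fun lam d \<delta> \<rho> \<alpha> - a_right lam d \<delta> \<rho> \<alpha>);
             bound_delta = lam ^ (q - 1) / (1 - lam ^ q) * (1 - lam) *
                             (1 - lam - d + d * indicator {0, 1} \<alpha>);
             bound_a = lam ^ (q - 1) / (1 - lam ^ q) *
                         ((1 - lam - d) * indicator {0, 1} \<alpha> + d);
             nonresonant = (\<forall>r\<in>{1..q - 1}. real (r * p) / real q \<notin> (\<lambda>z. z + \<alpha>) ` \<int>)
         in jump_delta \<ge> bound_delta \<and>
            (\<forall>\<delta>\<in>{0..1}. jump_a \<delta> \<ge> bound_a) \<and>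
            (jump_delta = bound_delta \<longleftrightarrow> nonresonant) \<and>
            (\<forall>\<delta>\<in>{0..1}. jump_a \<delta> = bound_a \<longleftrightarrow> nonresonant))"
    unfolding Let_def
    by (intro allI impI, elim conjE, intro conjI ballI) (rule rational_jumps[OF asms]; assumption)+
qed

end
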